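(* Let $n\in\mathbb N$, $n\ge 1$, and let $\alpha,\beta,h_1,\dots,h_{n-1}>0$. Let $(\theta,\varphi)$ be the TASEP random dynamical system with $n$ sites, entry rate $\alpha$, exit rate $\beta$ and internal rates $h_1,\dots,h_{n-1}$, on the state space $X=\{0,1\}^n$ over the probability space $(\Omega,\mathcal F,\mathbb P)$. Then the sets $$A(\omega):=\bigcap_{t\ge 0}\varphi(t,X,\theta_{-t}\omega),\qquad \omega\in\Omega,$$ define both a global random forward attractor and a global random pullback attractor, and almost surely the set $A(\omega)$ is a singleton.
   Context: Notation: $\mathbb R_0^+=[0,\infty)$; $\varphi(t,B,\omega)=\{\varphi(t,x,\omega):x\in B\}$ for $B\subseteq X$. Random dynamical system (RDS) on $X$: a measurable flow $\theta=\{\theta_t\}_{t\in\mathbb R}$ of $\mathbb P$-preserving maps on a probability space $(\Omega,\mathcal F,\mathbb P)$ ($\theta_0=\mathrm{id}$, $\theta_{s+t}=\theta_s\circ\theta_t$) together with a measurable map $\varphi:\mathbb R_0^+\times X\times\Omega\to X$, continuous in $x$, with $\varphi(0,x,\omega)=x$ and $\varphi(s+t,x,\omega)=\varphi(s,\varphi(t,x,\omega),\theta_t\omega)$. TASEP RDS. Single hop: for $x=(s_1,\dots,s_n)\in X=\{0,1\}^n$ (discrete topology) and $k\in\{0,\dots,n\}$ let $f(x,0)=(1,s_2,\dots,s_n)$; $f(x,n)=(s_1,\dots,s_{n-1},0)$; for $1\le k\le n-1$ with $s_k=1$ and $s_{k+1}=0$ let $f(x,k)=(s_1,\dots,s_{k-1},0,1,s_{k+2},\dots,s_n)$;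 and $f(x,k)=x$ otherwise. Clock space: for $\lambda>0$ let $\mathcal W^\lambda=(\hat\Omega,\hat{\mathcal F},\mathbb P^\lambda)$ be the space of sequences $(\xi_i)_{i\in\mathbb Z}$ with $\xi_0\ge 0$, $\xi_i>0$ for $i\ne 0$, and $\sum_{i\ge 0}\xi_i=\sum_{i\ge 1}\xi_{-i}=\infty$, with the (trace of the) product $\sigma$-algebra and the product measure under which the $\xi_i$ are i.i.d. exponential with rate $\lambda$ (the divergence conditions remove a null set). Define $\Phi((\xi_i)_i)=(Y_l)_{l\in\mathbb Z}$ by $Y_l=\sum_{i=0}^l\xi_i$ for $l\ge 0$ and $Y_l=-\sum_{i=1}^{-l}\xi_{-i}$ for $l<0$. $\Phi$ is a bijection from $\hat\Omega$ onto the strictly increasing sequences $(a_l)_{l\in\mathbb Z}$ with $a_{-1}<0\le a_0$ and $a_l\to\pm\infty$ as $l\to\pm\infty$; $\{Y_l\}$ is a homogeneous Poisson process on $\mathbb R$ with rate $\lambda$. For $t\in\mathbb R$ let $\hat\theta_t(\hat\omega)=\Phi^{-1}((b_l)_l)$, where $b_l=Y_{l+l_0}-t$ and $l_0$ is the unique integer with $Y_{l_0-1}-t<0\le Y_{l_0}-t$ (shift of the point configuration by $-t$). Probability space: put $h_0:=\alpha$, $h_n:=\beta$. $(\Omega,\mathcal F,\mathbb P)$ is the product $\mathcal W^{h_0}\times\mathcal W^{h_1}\times\cdots\times\mathcal W^{h_n}$ restricted to the full-measure event that all jump times $T_{k,j}(\omega):=\Phi(\omega_k)_j$ ($0\le k\le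 n$, $j\in\mathbb Z$) for different $k$ are distinct. Set $\theta_t(\omega_0,\dots,\omega_n)=(\hat\theta_t(\omega_0),\dots,\hat\theta_t(\omega_n))$. List all jump times in increasing order as $(t_i(\omega))_{i\in\mathbb Z}$ with $t_{-1}<0\le t_0$, and let $k_i(\omega)\in\{0,\dots,n\}$ be the index with $t_i(\omega)=T_{k_i,j}(\omega)$ for some $j$. Cocycle: $\varphi(t,x,\omega)=x$ if no $t_i(\omega)$ lies in $[0,t)$; otherwise, if $t_0(\omega)<\dots<t_m(\omega)$ are all the jump times in $[0,t)$, set $x_0=x$, $x_{p+1}=f(x_p,k_p(\omega))$ for $p=0,\dots,m$, and $\varphi(t,x,\omega)=x_{m+1}$. Attractors: on finite $X$ use the metric $d(x,y)=1$ for $x\ne y$, $d(x,x)=0$, and $\mathrm{dist}(C,B)=\sup_{c\in C}\inf_{b\in B}d(c,b)$. A random set is a measurable subset $A\subset X\times\Omega$ with sections $A(\omega)=\{x:(x,\omega)\in A\}$, compact if all sections are. A compact random set $A$ with $\varphi(t,A(\omega),\omega)=A(\theta_t\omega)$ for every $t\ge 0$ a.s. is a global random pullback attractor if $\lim_{t\to\infty}\mathrm{dist}(\varphi(t,X,\theta_{-t}\omega),A(\omega))=0$ a.s., and a global random forward attractor if $\lim_{t\to\infty}\mathrm{dist}(\varphi(t,X,\omega),A(\theta_t\omega))=0$ a.s. *)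

theory Defs
  imports "HOL-Probability.Probability"
begin

section \<open>Random attractors on a finite discrete state space\<close>

text \<open>
  The values are in \<^typ>\<open>ennreal\<close> so that the infimum over an empty \<open>B\<close> is \<open>\<infinity>\<close>
  and the supremum over an empty \<open>C\<close> is \<open>0\<close>.
\<close>

definition hausdorff_semidist :: "'a set \<Rightarrow> 'a set \<Rightarrow> ennreal" where
  "hausdorff_semidist C B = (SUP c\<in>C. INF b\<in>B. ennreal (discrete_metric.dd c b))"

text \<open>
  A random set \<open>A \<subseteq> X \<times> \<Omega>\<close> is given by its sections \<open>A \<omega>\<close>. The Borel sigma algebra of
  the finite discrete space \<open>X\<close> is that of \<^term>\<open>count_space X\<close>.
\<close>

definition random_set :: "'w measure \<Rightarrow> 'a set \<Rightarrow> ('w \<Rightarrow> 'a set) \<Rightarrow> bool" where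
  "random_set M X A \<longleftrightarrow>
     (\<forall>\<omega>\<in>space M. A \<omega> \<subseteq> X) \<and>
     {(x, \<omega>). \<omega> \<in> space M \<and> x \<in> A \<omega>} \<in> sets (count_space X \<Otimes>\<^sub>M M)"

definition compact_random_set :: "'w measure \<Rightarrow> 'a set \<Rightarrow> ('w \<Rightarrow> 'a set) \<Rightarrow> bool" where
  "compact_random_set M X A \<longleftrightarrow>
     random_set M X A \<and> (\<forall>\<omega>\<in>space M. compactin (discrete_topology X) (A \<omega>))"

definition invariant_random_set ::
  "'w measure \<Rightarrow> (real \<Rightarrow> 'w \<Rightarrow> 'w) \<Rightarrow> (real \<Rightarrow> 'a \<Rightarrow> 'w \<Rightarrow> 'a) \<Rightarrow> ('w \<Rightarrow> 'a set) \<Rightarrow> bool" where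
  "invariant_random_set M \<theta> \<phi> A \<longleftrightarrow>
     (AE \<omega> in M. \<forall>t\<ge>0. (\<lambda>x. \<phi> t x \<omega>) ` A \<omega> = A (\<theta> t \<omega>))"

definition global_random_pullback_attractor ::
  "'w measure \<Rightarrow> 'a set \<Rightarrow> (real \<Rightarrow> 'w \<Rightarrow> 'w) \<Rightarrow> (real \<Rightarrow> 'a \<Rightarrow> 'w \<Rightarrow> 'a) \<Rightarrow>
   ('w \<Rightarrow> 'a set) \<Rightarrow> bool" where
  "global_random_pullback_attractor M X \<theta> \<phi> A \<longleftrightarrow>
     compact_random_set M X A \<and> invariant_random_set M \<theta> \<phi> A \<and>
     (AE \<omega> in M.
        ((\<lambda>t. hausdorff_semidist ((\<lambda>x. \<phi> t x (\<theta> (- t) \<omega>)) ` X) (A \<omega>)) \<longlongrightarrow> 0) at_top)"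

definition global_random_forward_attractor ::
  "'w measure \<Rightarrow> 'a set \<Rightarrow> (real \<Rightarrow> 'w \<Rightarrow> 'w) \<Rightarrow> (real \<Rightarrow> 'a \<Rightarrow> 'w \<Rightarrow> 'a) \<Rightarrow>
   ('w \<Rightarrow> 'a set) \<Rightarrow> bool" where
  "global_random_forward_attractor M X \<theta> \<phi> A \<longleftrightarrow>
     compact_random_set M X A \<and> invariant_random_set M \<theta> \<phi> A \<and>
     (AE \<omega> in M.
        ((\<lambda>t. hausdorff_semidist ((\<lambda>x. \<phi> t x \<omega>) ` X) (A (\<theta> t \<omega>))) \<longlongrightarrow> 0) at_top)"


section \<open>States and single hops\<close>

definition tasep_states :: "nat \<Rightarrow> (nat \<Rightarrow> nat) set" where
  "tasep_states n = ({1..n} \<rightarrow>\<^sub>E {0, 1})"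

definition hop :: "nat \<Rightarrow> (nat \<Rightarrow> nat) \<Rightarrow> nat \<Rightarrow> (nat \<Rightarrow> nat)" where
  "hop n x k =
     (if k = 0 then x(1 := 1)
      else if k = n then x(n := 0)
      else if 1 \<le> k \<and> k \<le> n - 1 \<and> x k = 1 \<and> x (k + 1) = 0 then x(k := 0, k + 1 := 1)
      else x)"


section \<open>A single Poisson clock\<close>

definition clock_seqs :: "(int \<Rightarrow> real) set" where
  "clock_seqs = {\<xi>. \<xi> 0 \<ge> 0 \<and> (\<forall>i. i \<noteq> 0 \<longrightarrow> \<xi> i > 0) \<and>
     filterlim (\<lambda>m::nat. \<Sum>i=0..m. \<xi> (int i)) at_top sequentially \<and>
     filterlim (\<lambda>m::nat. \<Sum>i=1..m. \<xi> (- int i)) at_top sequentially}"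

definition clock_space :: "real \<Rightarrow> (int \<Rightarrow> real) measure" where
  "clock_space r =
     restrict_space (\<Pi>\<^sub>M i\<in>UNIV. density lborel (exponential_density r)) clock_seqs"

definition arrival_times :: "(int \<Rightarrow> real) \<Rightarrow> (int \<Rightarrow> real)" where
  "arrival_times \<xi> l = (if l \<ge> 0 then \<Sum>i=0..l. \<xi> i else - (\<Sum>i=1..-l. \<xi> (- i)))"

definition shift_index :: "real \<Rightarrow> (int \<Rightarrow> real) \<Rightarrow> int" where
  "shift_index t \<xi> = (THE l. arrival_times \<xi> (l - 1) - t < 0 \<and> 0 \<le> arrival_times \<xi> l - t)"

definition clock_shift :: "real \<Rightarrow> (int \<Rightarrow> real) \<Rightarrow> (int \<Rightarrow> real)" where
  "clock_shift t \<xi> =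
     inv_into clock_seqs arrival_times (\<lambda>l. arrival_times \<xi> (l + shift_index t \<xi>) - t)"


section \<open>The TASEP random dynamical system\<close>

definition tasep_rate :: "real \<Rightarrow> real \<Rightarrow> (nat \<Rightarrow> real) \<Rightarrow> nat \<Rightarrow> (nat \<Rightarrow> real)" where
  "tasep_rate \<alpha> \<beta> h n = h(0 := \<alpha>, n := \<beta>)"

definition distinct_arrivals :: "nat \<Rightarrow> (nat \<Rightarrow> int \<Rightarrow> real) set" where
  "distinct_arrivals n =
     {\<omega>. \<forall>k\<in>{0..n}. \<forall>k'\<in>{0..n}. k \<noteq> k' \<longrightarrow>
        (\<forall>i j. arrival_times (\<omega> k) i \<noteq> arrival_times (\<omega> k') j)}"

definition tasep_space ::
  "real \<Rightarrow> real \<Rightarrow> (nat \<Rightarrow> real) \<Rightarrow> nat \<Rightarrow> (nat \<Rightarrow> int \<Rightarrow> real) measure" where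
  "tasep_space \<alpha> \<beta> h n =
     restrict_space (\<Pi>\<^sub>M k\<in>{0..n}. clock_space (tasep_rate \<alpha> \<beta> h n k)) (distinct_arrivals n)"

definition tasep_flow ::
  "nat \<Rightarrow> real \<Rightarrow> (nat \<Rightarrow> int \<Rightarrow> real) \<Rightarrow> (nat \<Rightarrow> int \<Rightarrow> real)" where
  "tasep_flow n t \<omega> = (\<lambda>k\<in>{0..n}. clock_shift t (\<omega> k))"

definition jump_times :: "nat \<Rightarrow> (nat \<Rightarrow> int \<Rightarrow> real) \<Rightarrow> int \<Rightarrow> real" where
  "jump_times n \<omega> =
     (THE \<tau>. strict_mono \<tau> \<and>
        range \<tau> = {arrival_times (\<omega> k) j | k j. k \<in> {0..n}} \<and> \<tau> (- 1) < 0 \<and> 0 \<le> \<tau> 0)"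

definition jump_index :: "nat \<Rightarrow> (nat \<Rightarrow> int \<Rightarrow> real) \<Rightarrow> int \<Rightarrow> nat" where
  "jump_index n \<omega> i = (THE k. k \<in> {0..n} \<and> (\<exists>j. jump_times n \<omega> i = arrival_times (\<omega> k) j))"

primrec tasep_iter :: "nat \<Rightarrow> (nat \<Rightarrow> int \<Rightarrow> real) \<Rightarrow> (nat \<Rightarrow> nat) \<Rightarrow> nat \<Rightarrow> (nat \<Rightarrow> nat)" where
  "tasep_iter n \<omega> x 0 = x"
| "tasep_iter n \<omega> x (Suc p) = hop n (tasep_iter n \<omega> x p) (jump_index n \<omega> (int p))"

text \<open>
  If the jump times in \<open>[0, t)\<close> are those with indices \<open>0, \<dots>, m\<close>, there are \<open>m + 1\<close> of them;
  if there are none, the state is unchanged.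
\<close>

definition tasep_cocycle ::
  "nat \<Rightarrow> real \<Rightarrow> (nat \<Rightarrow> nat) \<Rightarrow> (nat \<Rightarrow> int \<Rightarrow> real) \<Rightarrow> (nat \<Rightarrow> nat)" where
  "tasep_cocycle n t x \<omega> = tasep_iter n \<omega> x (card {i. jump_times n \<omega> i \<in> {0..<t}})"

definition tasep_attractor :: "nat \<Rightarrow> (nat \<Rightarrow> int \<Rightarrow> real) \<Rightarrow> (nat \<Rightarrow> nat) set" where
  "tasep_attractor n \<omega> =
     (\<Inter>t\<in>{0..}. (\<lambda>x. tasep_cocycle n t x (tasep_flow n (- t) \<omega>)) ` tasep_states n)"

end

(*
  All images phi(t, X, theta_{-t} omega) decrease as t grows, and X is finite, so they stabilise;
  this gives invariance and pullback convergence for every omega. The word [n, n-1, ..., 1]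
  (no entrance rings) moves every particle one site to the right, so its n-th power empties the
  system from every initial state. Once this word occurs as a factor of the rings after time 0,
  all trajectories coincide (forward convergence), and once it occurs before time 0, the attractor
  is a singleton. It occurs almost surely on both sides: the numbers of rings of the clocks in
  consecutive unit intervals are independent Poisson variables, so the probability that none of
  R disjoint blocks of unit intervals carries the word, one ring per unit interval, is at most
  (1 - p)^R for some p > 0.
*)
theory Submission
  imports Defs
begin

section \<open>Enumerating a locally finite set of times\<close>

text \<open>The clocks are given by i.i.d. gaps, not as Poisson processes, so independence over
  disjoint time intervals has to be derived. Time 0 cuts the gap sequence of a clock into
  \<open>\<xi> 0, \<xi> 1, ...\<close> and \<open>\<xi> (- 1), \<xi> (- 2), ...\<close>; both are
  i.i.d. exponential and start a renewal process at 0, one running forwards and one backwards. A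
  single one-sided estimate therefore serves both directions; backwards the rings are met in reverse
  order, so the word sought there is reversed. Asking for one ring per unit interval fixes the order
  of the rings of different clocks by counts alone, so that the interleaving of the clocks within an
  interval never has to be analysed. On the deterministic side, jump times, jump indices and shifts
  are definite descriptions or inverses; they are first shown to be meaningful and then traded for
  the word of rings in a half-open window \<open>[a, b)\<close>. There the flow translates windows
  and the cocycle property becomes concatenation of words.\<close>

definition time_rank :: "real set \<Rightarrow> real \<Rightarrow> int" where
  "time_rank S s = (if 0 \<le> s then int (card (S \<inter> {0..<s})) else - int (card (S \<inter> {s..<0})))"

locale locally_finite_times =
  fixes S :: "real set"
  assumes fin: "finite (S \<inter> {a..b})"
    and unbounded_above: "\<exists>s\<in>S. a < s"
    and unbounded_below: "\<exists>s\<in>S. s < a"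
begin

lemma finite_Int [simp]: "finite (S \<inter> {a..<b})" "finite (S \<inter> {a<..b})" "finite (S \<inter> {a<..<b})"
  by (rule finite_subset[OF _ fin[of a b]]; auto)+

lemma successor: obtains s where "s \<in> S" "a < s" "S \<inter> {a<..<s} = {}"
proof -
  obtain u where u: "u \<in> S" "a < u" using unbounded_above by blast
  let ?s = "Min (S \<inter> {a<..u})"
  have ne: "S \<inter> {a<..u} \<noteq> {}" using u by auto
  have "?s \<in> S \<inter> {a<..u}" using ne by (intro Min_in) auto
  moreover have "S \<inter> {a<..<?s} = {}"
  proof (rule ccontr)
    assume "S \<inter> {a<..<?s} \<noteq> {}"
    then obtain v where v: "v \<in> S" "a < v" "v < ?s" by auto
    with \<open>?s \<in> _\<close> have "v \<in> S \<inter> {a<..u}" by auto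
    then have "?s \<le> v" by (intro Min_le) auto
    with v show False by simp
  qed
  ultimately show thesis using that by auto
qed

lemma predecessor: obtains s where "s \<in> S" "s < a" "S \<inter> {s<..<a} = {}"
proof -
  obtain u where u: "u \<in> S" "u < a" using unbounded_below by blast
  let ?s = "Max (S \<inter> {u..<a})"
  have ne: "S \<inter> {u..<a} \<noteq> {}" using u by auto
  have "?s \<in> S \<inter> {u..<a}" using ne by (intro Max_in) auto
  moreover have "S \<inter> {?s<..<a} = {}"
  proof (rule ccontr)
    assume "S \<inter> {?s<..<a} \<noteq> {}"
    then obtain v where v: "v \<in> S" "?s < v" "v < a" by auto
    with \<open>?s \<in> _\<close> have "v \<in> S \<inter> {u..<a}" by auto
    then have "v \<le> ?s" by (intro Max_ge) auto
    with v show False by simp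
  qed
  ultimately show thesis using that by auto
qed

lemma time_rank_strict_mono:
  assumes "s \<in> S" "s' \<in> S" "s < s'"
  shows "time_rank S s < time_rank S s'"
proof -
  consider "0 \<le> s" | "s < 0" "0 \<le> s'" | "s' < 0" using assms by linarith
  then show ?thesis
  proof cases
    case 1
    then have "S \<inter> {0..<s} \<subset> S \<inter> {0..<s'}" using assms by auto
    then have "card (S \<inter> {0..<s}) < card (S \<inter> {0..<s'})" by (intro psubset_card_mono) auto
    with 1 assms show ?thesis by (simp add: time_rank_def)
  next
    case 2
    then have "S \<inter> {s..<0} \<noteq> {}" using assms by auto
    then have "0 < card (S \<inter> {s..<0})" by (simp add: card_gt_0_iff)
    with 2 show ?thesis by (simp add: time_rank_def)
  next
    case 3
    then have "s' \<in> S \<inter> {s'..<0}" "s \<in> S \<inter> {s..<0}" "s \<notin> S \<inter> {s'..<0}" using assms by auto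
    then have "S \<inter> {s'..<0} \<subset> S \<inter> {s..<0}" using assms by fastforce
    then have "card (S \<inter> {s'..<0}) < card (S \<inter> {s..<0})" by (intro psubset_card_mono) auto
    with 3 assms show ?thesis by (simp add: time_rank_def)
  qed
qed

text \<open>Starting at 0 and passing to the next point of \<open>S\<close> on either side reaches
  every rank. A negative point counts itself, so the largest negative point has rank -1, in
  agreement with the normalisation \<open>\<tau> (- 1) < 0 \<le> \<tau> 0\<close>.\<close>

lemma time_rank_surj: "\<exists>s\<in>S. time_rank S s = i"
proof -
  have pos: "\<exists>s\<in>S. 0 \<le> s \<and> card (S \<inter> {0..<s}) = m" for m
  proof (induction m)
    case 0
    show ?case
    proof (cases "0 \<in> S")
      case False
      obtain s where s: "s \<in> S" "0 < s" "S \<inter> {0<..<s} = {}" by (rule successor)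
      with False have "S \<inter> {0..<s} = {}" by (auto simp: less_le)
      with s show ?thesis by (intro bexI[of _ s]) auto
    qed auto
  next
    case (Suc m)
    then obtain s where s: "s \<in> S" "0 \<le> s" "card (S \<inter> {0..<s}) = m" by blast
    obtain s' where s': "s' \<in> S" "s < s'" "S \<inter> {s<..<s'} = {}" by (rule successor)
    have "S \<inter> {0..<s'} = insert s (S \<inter> {0..<s})" using s s' by (fastforce simp: not_less)
    with s s' show ?case by (intro bexI[of _ s']) auto
  qed
  have neg: "\<exists>s\<in>S. s < 0 \<and> card (S \<inter> {s..<0}) = Suc m" for m
  proof (induction m)
    case 0
    obtain s where s: "s \<in> S" "s < 0" "S \<inter> {s<..<0} = {}" by (rule predecessor)
    then have "S \<inter> {s..<0} = {s}" by (fastforce simp: less_le)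
    with s show ?case by (intro bexI[of _ s]) auto
  next
    case (Suc m)
    then obtain s where s: "s \<in> S" "s < 0" "card (S \<inter> {s..<0}) = Suc m" by blast
    obtain s' where s': "s' \<in> S" "s' < s" "S \<inter> {s'<..<s} = {}" by (rule predecessor)
    have "S \<inter> {s'..<0} = insert s' (S \<inter> {s..<0})"
    proof (intro set_eqI iffI)
      fix u assume "u \<in> S \<inter> {s'..<0}"
      then show "u \<in> insert s' (S \<inter> {s..<0})" using s'(3) by (cases "u < s") (auto simp: less_le)
    qed (use s s' in auto)
    with s s' show ?case by (intro bexI[of _ s']) auto
  qed
  show ?thesis
  proof (cases "0 \<le> i")
    case True
    then show ?thesis using pos[of "nat i"] by (force simp: time_rank_def)
  next
    case False
    then have "int (Suc (nat (- i) - 1)) = - i" by simp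
    with neg[of "nat (- i) - 1"] obtain s where "s \<in> S" "s < 0" "int (card (S \<inter> {s..<0})) = - i"
      by metis
    then show ?thesis by (intro bexI[of _ s]) (auto simp: time_rank_def)
  qed
qed

text \<open>\<open>time_rank S\<close> is a strictly increasing bijection from \<open>S\<close> onto
  the integers, and its inverse is the enumeration. Any enumeration with this normalisation has rank
  \<open>i\<close> at index \<open>i\<close>, which gives uniqueness. This makes the definite
  description in \<open>jump_times\<close> meaningful.\<close>

lemma ex1_enumeration:
  "\<exists>!\<tau>::int \<Rightarrow> real. strict_mono \<tau> \<and> range \<tau> = S \<and> \<tau> (- 1) < 0 \<and> 0 \<le> \<tau> 0"
proof (rule ex_ex1I)
  have inj: "inj_on (time_rank S) S"
    by (metis inj_onI less_irrefl linorder_neqE time_rank_strict_mono)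
  have im: "time_rank S ` S = UNIV" using time_rank_surj by (metis UNIV_eq_I image_eqI)
  define \<tau> where "\<tau> = inv_into S (time_rank S)"
  have \<tau>: "\<tau> i \<in> S" "time_rank S (\<tau> i) = i" for i
    unfolding \<tau>_def by (simp_all add: inv_into_into f_inv_into_f im)
  have "strict_mono \<tau>"
  proof
    fix i j :: int assume "i < j"
    then have "time_rank S (\<tau> i) < time_rank S (\<tau> j)" by (simp add: \<tau>)
    then show "\<tau> i < \<tau> j" by (metis \<tau>(1) less_asym' linorder_neqE time_rank_strict_mono)
  qed
  moreover have "range \<tau> = S"
    unfolding \<tau>_def by (metis im inj inj_imp_bij_betw_inv bij_betw_def bij_betw_inv_into)
  moreover have "\<tau> (- 1) < 0" using \<tau>(2)[of "- 1"] by (auto simp: time_rank_def split: if_splits)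
  moreover have "0 \<le> \<tau> 0"
  proof (rule ccontr)
    assume "\<not> 0 \<le> \<tau> 0"
    then have "\<tau> 0 \<in> S \<inter> {\<tau> 0..<0}" using \<tau>(1) by auto
    then have "S \<inter> {\<tau> 0..<0} \<noteq> {}" by blast
    then have "0 < card (S \<inter> {\<tau> 0..<0})" by (simp add: card_gt_0_iff)
    with \<open>\<not> 0 \<le> \<tau> 0\<close> \<tau>(2)[of 0] show False by (simp add: time_rank_def)
  qed
  ultimately show "\<exists>\<tau>::int \<Rightarrow> real. strict_mono \<tau> \<and> range \<tau> = S \<and> \<tau> (- 1) < 0 \<and> 0 \<le> \<tau> 0" by blast
next
  have rank: "time_rank S (\<tau> i) = i"
    if \<tau>: "strict_mono \<tau> \<and> range \<tau> = S \<and> \<tau> (- 1) < 0 \<and> 0 \<le> \<tau> 0" for \<tau> :: "int \<Rightarrow> real" and i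
  proof -
    have sm: "\<tau> i < \<tau> j \<longleftrightarrow> i < j" "\<tau> i \<le> \<tau> j \<longleftrightarrow> i \<le> j" for i j
      using \<tau> by (auto simp: strict_mono_less strict_mono_less_eq)
    have nonneg: "0 \<le> \<tau> j \<longleftrightarrow> 0 \<le> j" for j
    proof
      assume "0 \<le> \<tau> j"
      then show "0 \<le> j" using \<tau> sm(2)[of j "- 1"] by (cases "j \<le> - 1") auto
    next
      assume "0 \<le> j"
      then show "0 \<le> \<tau> j" using \<tau> sm(2)[of 0 j] by auto
    qed
    have neg: "\<tau> j < 0 \<longleftrightarrow> j < 0" for j using nonneg[of j] by (simp add: not_le[symmetric])
    have S: "S = range \<tau>" using \<tau> by auto
    have inj: "inj_on \<tau> A" for A using \<tau> by (meson strict_mono_imp_inj_on inj_on_subset subset_UNIV)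
    have "S \<inter> {0..<\<tau> i} = \<tau> ` {0..<i}" "S \<inter> {\<tau> i..<0} = \<tau> ` {i..<0}"
      unfolding S by (auto simp: sm nonneg neg)
    then show ?thesis unfolding time_rank_def using nonneg[of i]
      by (simp add: card_image[OF inj])
  qed
  fix \<tau> \<tau>' :: "int \<Rightarrow> real"
  assume \<tau>: "strict_mono \<tau> \<and> range \<tau> = S \<and> \<tau> (- 1) < 0 \<and> 0 \<le> \<tau> 0"
    and \<tau>': "strict_mono \<tau>' \<and> range \<tau>' = S \<and> \<tau>' (- 1) < 0 \<and> 0 \<le> \<tau>' 0"
  show "\<tau> = \<tau>'"
  proof
    fix i
    have "\<tau>' i \<in> range \<tau>" using \<tau> \<tau>' by auto
    then obtain j where "\<tau>' i = \<tau> j" by auto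
    then show "\<tau> i = \<tau>' i" using rank[OF \<tau>, of j] rank[OF \<tau>', of i] by simp
  qed
qed

end

section \<open>Arrival times of a single clock\<close>

text \<open>These sequences turn out to be exactly the image of \<open>clock_seqs\<close> under
  \<open>arrival_times\<close>; membership in that image is what the \<open>inv_into\<close> in
  \<open>clock_shift\<close> requires.\<close>

definition clock_arrivals :: "(int \<Rightarrow> real) \<Rightarrow> bool" where
  "clock_arrivals b \<longleftrightarrow> strict_mono b \<and> b (- 1) < 0 \<and> 0 \<le> b 0 \<and>
     (\<forall>a. \<exists>l. a < b l) \<and> (\<forall>a. \<exists>l. b l < a)"

lemma arrival_times_0: "arrival_times \<xi> 0 = \<xi> 0"
  by (simp add: arrival_times_def)

lemma arrival_times_succ: "0 \<le> l \<Longrightarrow> arrival_times \<xi> (l + 1) = arrival_times \<xi> l + \<xi> (l + 1)"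
  using atLeastAtMostPlus1_int_conv[of 0 l] by (simp add: arrival_times_def add.commute)

lemma arrival_times_minus_1: "arrival_times \<xi> (- 1) = - \<xi> (- 1)"
  by (simp add: arrival_times_def)

lemma arrival_times_pred:
  "1 \<le> l \<Longrightarrow> arrival_times \<xi> (- l - 1) = arrival_times \<xi> (- l) - \<xi> (- l - 1)"
  using atLeastAtMostPlus1_int_conv[of 1 l] by (simp add: arrival_times_def add.commute minus_diff_commute)

lemma arrival_times_of_nat:
  "arrival_times \<xi> (int l) = (\<Sum>i<Suc l. \<xi> (int i))"
proof (induction l)
  case (Suc l)
  then show ?case using arrival_times_succ[of "int l" \<xi>] by (simp add: add.commute)
qed (simp add: arrival_times_0)

lemma arrival_times_minus_Suc:
  "arrival_times \<xi> (- int (Suc l)) = - (\<Sum>i<Suc l. \<xi> (- int (Suc i)))"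
proof (induction l)
  case (Suc l)
  then show ?case using arrival_times_pred[of "int (Suc l)" \<xi>] by (simp add: algebra_simps)
qed (simp add: arrival_times_minus_1)

lemma strict_mono_intI:
  fixes b :: "int \<Rightarrow> real"
  assumes "\<And>l. b l < b (l + 1)"
  shows "strict_mono b"
proof
  fix i j :: int assume "i < j"
  then show "b i < b j"
    by (induction rule: int_gr_induct) (use assms less_trans in blast)+
qed

lemma clock_arrivals_arrival_times:
  assumes "\<xi> \<in> clock_seqs"
  shows "clock_arrivals (arrival_times \<xi>)"
proof -
  have pos: "0 \<le> \<xi> 0" "\<And>i. i \<noteq> 0 \<Longrightarrow> 0 < \<xi> i"
    and up: "filterlim (\<lambda>m::nat. \<Sum>i=0..m. \<xi> (int i)) at_top sequentially"
    and down: "filterlim (\<lambda>m::nat. \<Sum>i=1..m. \<xi> (- int i)) at_top sequentially"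
    using assms by (auto simp: clock_seqs_def)
  have "strict_mono (arrival_times \<xi>)"
  proof (rule strict_mono_intI)
    fix l :: int
    consider "0 \<le> l" | "l = - 1" | "l < - 1" by linarith
    then show "arrival_times \<xi> l < arrival_times \<xi> (l + 1)"
    proof cases
      case 1 then show ?thesis using pos(2)[of "l + 1"] by (simp add: arrival_times_succ)
    next
      case 2 then show ?thesis
        using pos(1) pos(2)[of "- 1"] by (simp add: arrival_times_0 arrival_times_minus_1)
    next
      case 3 then show ?thesis
        using arrival_times_pred[of "- l - 1" \<xi>] pos(2)[of l] by (simp add: algebra_simps)
    qed
  qed
  moreover have "\<exists>l. a < arrival_times \<xi> l" for a
  proof -
    from up obtain m where "a + 1 \<le> (\<Sum>i=0..m. \<xi> (int i))"
      by (metis eventually_at_top_linorder filterlim_at_top order_refl)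
    then have "a < arrival_times \<xi> (int m)"
      by (simp add: arrival_times_of_nat lessThan_Suc_atMost atLeast0AtMost)
    then show ?thesis by blast
  qed
  moreover have "\<exists>l. arrival_times \<xi> l < a" for a
  proof -
    from down obtain N where "\<forall>m\<ge>N. 1 - a \<le> (\<Sum>i=1..m. \<xi> (- int i))"
      by (metis eventually_at_top_linorder filterlim_at_top)
    then have "1 - a \<le> (\<Sum>i=1..Suc N. \<xi> (- int i))" by (meson le_SucI order_refl)
    also have "\<dots> = (\<Sum>i<Suc N. \<xi> (- int (Suc i)))"
      by (rule sum.reindex_bij_witness[of _ Suc "\<lambda>i. i - 1"]) auto
    finally have "arrival_times \<xi> (- int (Suc N)) < a"
      by (simp only: arrival_times_minus_Suc)
    then show ?thesis by blast
  qed
  ultimately show ?thesis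
    using pos(1) pos(2)[of "- 1"]
    by (simp add: clock_arrivals_def arrival_times_0 arrival_times_minus_1)
qed

lemma clock_arrivals_in_image:
  assumes "clock_arrivals b"
  shows "b \<in> arrival_times ` clock_seqs"
proof -
  have sm: "strict_mono b" and sgn: "b (- 1) < 0" "0 \<le> b 0"
    and up: "\<And>a. \<exists>l. a < b l" and down: "\<And>a. \<exists>l. b l < a"
    using assms by (auto simp: clock_arrivals_def)
  \<comment> \<open>Gaps are differences of neighbours, except that the interval from
    \<open>b (- 1)\<close> to \<open>b 0\<close> is cut at the origin into
    \<open>\<xi> (- 1)\<close> and \<open>\<xi> 0\<close>. Hence \<open>\<xi> 0\<close> may vanish
    while all other gaps are positive.\<close>
  define \<xi> where "\<xi> i = (if i = 0 then b 0 else if i = - 1 then - b (- 1)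
    else if 0 < i then b i - b (i - 1) else b (i + 1) - b i)" for i
  have nat1: "arrival_times \<xi> (int l) = b (int l)" for l
  proof (induction l)
    case (Suc l)
    moreover have "\<xi> (int l + 1) = b (int l + 1) - b (int l)" by (simp add: \<xi>_def)
    ultimately show ?case using arrival_times_succ[of "int l" \<xi>] by (simp add: add.commute)
  qed (simp add: arrival_times_0 \<xi>_def)
  have nat2: "arrival_times \<xi> (- int (Suc l)) = b (- int (Suc l))" for l
  proof (induction l)
    case (Suc l)
    have "- int (Suc l) - 1 = - int (Suc (Suc l))" by simp
    moreover have "\<xi> (- int (Suc l) - 1) = b (- int (Suc l)) - b (- int (Suc l) - 1)"
      by (simp add: \<xi>_def)
    ultimately show ?case using Suc arrival_times_pred[of "int (Suc l)" \<xi>] by simp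
  qed (simp add: arrival_times_minus_1 \<xi>_def)
  have eq: "arrival_times \<xi> = b"
  proof
    fix l :: int
    show "arrival_times \<xi> l = b l"
    proof (cases "0 \<le> l")
      case True then show ?thesis using nat1[of "nat l"] by simp
    next
      case False
      then have "l = - int (Suc (nat (- l) - 1))" by auto
      then show ?thesis using nat2 by metis
    qed
  qed
  have "0 < \<xi> i" if "i \<noteq> 0" for i
    using that sgn strict_monoD[OF sm, of "i - 1" i] strict_monoD[OF sm, of i "i + 1"]
    by (auto simp: \<xi>_def)
  moreover have "0 \<le> \<xi> 0" using sgn by (simp add: \<xi>_def)
  moreover have "filterlim (\<lambda>m::nat. \<Sum>i=0..m. \<xi> (int i)) at_top sequentially"
  proof -
    have *: "(\<Sum>i=0..m. \<xi> (int i)) = b (int m)" for m :: nat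
      using nat1[of m] by (simp add: arrival_times_of_nat lessThan_Suc_atMost atLeast0AtMost)
    show ?thesis unfolding * filterlim_at_top eventually_at_top_linorder
    proof
      fix Z
      obtain l where "Z < b l" using up by blast
      moreover have "b l \<le> b (int m)" if "nat l \<le> m" for m
        using that sm by (simp add: strict_mono_less_eq nat_le_iff)
      ultimately show "\<exists>N. \<forall>m\<ge>N. Z \<le> b (int m)" by (meson less_imp_le order_trans)
    qed
  qed
  moreover have "filterlim (\<lambda>m::nat. \<Sum>i=1..m. \<xi> (- int i)) at_top sequentially"
  proof -
    have *: "(\<Sum>i=1..m. \<xi> (- int i)) = - b (- int m)" if "1 \<le> m" for m :: nat
    proof -
      obtain m' where m: "m = Suc m'" using \<open>1 \<le> m\<close> by (cases m) auto
      have "(\<Sum>i=1..m. \<xi> (- int i)) = (\<Sum>i<Suc m'. \<xi> (- int (Suc i)))"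
        unfolding m by (rule sum.reindex_bij_witness[of _ Suc "\<lambda>i. i - 1"]) auto
      then show ?thesis
        using nat2[of m'] arrival_times_minus_Suc[of \<xi> m'] by (simp only: m)
    qed
    show ?thesis unfolding filterlim_at_top eventually_at_top_linorder
    proof
      fix Z
      obtain l where l: "b l < - Z" using down by blast
      have "Z \<le> (\<Sum>i=1..m. \<xi> (- int i))" if "max 1 (nat (- l)) \<le> m" for m
      proof -
        have "b (- int m) \<le> b l" using that sm by (simp add: strict_mono_less_eq nat_le_iff)
        then show ?thesis using l that by (subst *) auto
      qed
      then show "\<exists>N. \<forall>m\<ge>N. Z \<le> (\<Sum>i=1..m. \<xi> (- int i))" by blast
    qed
  qed
  ultimately have "\<xi> \<in> clock_seqs" by (auto simp: clock_seqs_def)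
  then show ?thesis using eq by auto
qed

lemma clock_arrivals_first_index:
  assumes "clock_arrivals b"
  shows "\<exists>!l. b (l - 1) - t < 0 \<and> 0 \<le> b l - t"
proof (rule ex_ex1I)
  have sm: "strict_mono b" using assms by (simp add: clock_arrivals_def)
  obtain l1 l2 where l: "b l1 < t" "t < b l2" using assms unfolding clock_arrivals_def by meson
  then have "l1 < l2" using sm by (metis less_trans strict_mono_less)
  define m where "m = (LEAST m. t \<le> b (l1 + int m))"
  have "t \<le> b (l1 + int (nat (l2 - l1)))" using l \<open>l1 < l2\<close> by simp
  then have m: "t \<le> b (l1 + int m)" unfolding m_def by (rule LeastI)
  with l have "m \<noteq> 0" by (intro notI) simp
  then have "\<not> t \<le> b (l1 + int (m - 1))" 
    using not_less_Least[of "m - 1" "\<lambda>m. t \<le> b (l1 + int m)"] unfolding m_def by simp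
  with m \<open>m \<noteq> 0\<close> show "\<exists>l. b (l - 1) - t < 0 \<and> 0 \<le> b l - t"
    by (intro exI[of _ "l1 + int m"]) (simp add: of_nat_diff add_diff_eq)
next
  have sm: "strict_mono b" using assms by (simp add: clock_arrivals_def)
  fix l l' assume a: "b (l - 1) - t < 0 \<and> 0 \<le> b l - t" "b (l' - 1) - t < 0 \<and> 0 \<le> b l' - t"
  then have "b (l - 1) < b l'" "b (l' - 1) < b l" by auto
  then show "l = l'" using sm by (simp add: strict_mono_less)
qed

lemma clock_shift:
  assumes "\<xi> \<in> clock_seqs"
  shows "clock_shift t \<xi> \<in> clock_seqs"
    and "arrival_times (clock_shift t \<xi>) l = arrival_times \<xi> (l + shift_index t \<xi>) - t"
proof -
  let ?b = "\<lambda>l. arrival_times \<xi> (l + shift_index t \<xi>) - t"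
  note b = clock_arrivals_arrival_times[OF assms]
  have sm: "strict_mono (arrival_times \<xi>)" and up: "\<And>a. \<exists>l. a < arrival_times \<xi> l"
    and down: "\<And>a. \<exists>l. arrival_times \<xi> l < a"
    using b by (auto simp: clock_arrivals_def)
  have "arrival_times \<xi> (shift_index t \<xi> - 1) - t < 0 \<and> 0 \<le> arrival_times \<xi> (shift_index t \<xi>) - t"
    unfolding shift_index_def by (rule theI'[OF clock_arrivals_first_index[OF b]])
  moreover have "strict_mono ?b" using sm by (auto intro!: strict_monoI simp: strict_mono_less)
  moreover have "\<exists>l. a < ?b l" for a
  proof -
    obtain l where "a + t < arrival_times \<xi> l" using up by blast
    then show ?thesis by (intro exI[of _ "l - shift_index t \<xi>"]) simp
  qed
  moreover have "\<exists>l. ?b l < a" for a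
  proof -
    obtain l where "arrival_times \<xi> l < a + t" using down by blast
    then show ?thesis by (intro exI[of _ "l - shift_index t \<xi>"]) simp
  qed
  ultimately have "clock_arrivals ?b" by (simp add: clock_arrivals_def add.commute)
  note im = clock_arrivals_in_image[OF this]
  show "clock_shift t \<xi> \<in> clock_seqs" unfolding clock_shift_def by (rule inv_into_into[OF im])
  show "arrival_times (clock_shift t \<xi>) l = ?b l"
    unfolding clock_shift_def by (simp add: f_inv_into_f[OF im])
qed

text \<open>The relabelling by \<open>shift_index\<close> disappears when only the set of arrivals
  is kept. The ring times and ring sites of a shifted path are read off from this set
  identity.\<close>

lemma arrival_times_clock_shift_range:
  assumes "\<xi> \<in> clock_seqs"
  shows "range (arrival_times (clock_shift t \<xi>)) = (\<lambda>u. u - t) ` range (arrival_times \<xi>)"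
proof (intro set_eqI iffI)
  fix u assume "u \<in> (\<lambda>u. u - t) ` range (arrival_times \<xi>)"
  then obtain l where "u = arrival_times \<xi> l - t" by auto
  then have "u = arrival_times (clock_shift t \<xi>) (l - shift_index t \<xi>)"
    by (simp add: clock_shift[OF assms])
  then show "u \<in> range (arrival_times (clock_shift t \<xi>))" by blast
qed (auto simp: clock_shift[OF assms])

section \<open>The word of rings in a time window\<close>

text \<open>Carrier of the probability space \<open>tasep_space\<close>, whatever the rates
  are.\<close>

definition tasep_paths :: "nat \<Rightarrow> (nat \<Rightarrow> int \<Rightarrow> real) set" where
  "tasep_paths n = ({0..n} \<rightarrow>\<^sub>E clock_seqs) \<inter> distinct_arrivals n"

definition ring_times :: "nat \<Rightarrow> (nat \<Rightarrow> int \<Rightarrow> real) \<Rightarrow> real set" where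
  "ring_times n \<omega> = {arrival_times (\<omega> k) j | k j. k \<in> {0..n}}"

definition ring_site :: "nat \<Rightarrow> (nat \<Rightarrow> int \<Rightarrow> real) \<Rightarrow> real \<Rightarrow> nat" where
  "ring_site n \<omega> s = (THE k. k \<in> {0..n} \<and> (\<exists>j. s = arrival_times (\<omega> k) j))"

text \<open>Stated for arbitrary sets of times, since the synchronising word will be located in
  unions of intervals that need not have the form \<open>[a, b)\<close>.\<close>

definition sites_of :: "nat \<Rightarrow> (nat \<Rightarrow> int \<Rightarrow> real) \<Rightarrow> real set \<Rightarrow> nat list" where
  "sites_of n \<omega> F = map (ring_site n \<omega>) (sorted_list_of_set F)"

text \<open>Windows are closed on the left and open on the right, as in
  \<open>tasep_cocycle\<close>: adjacent windows then share no ring and their words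
  concatenate.\<close>

definition ring_word :: "nat \<Rightarrow> (nat \<Rightarrow> int \<Rightarrow> real) \<Rightarrow> real \<Rightarrow> real \<Rightarrow> nat list" where
  "ring_word n \<omega> a b = sites_of n \<omega> (ring_times n \<omega> \<inter> {a..<b})"

definition hops :: "nat \<Rightarrow> nat list \<Rightarrow> (nat \<Rightarrow> nat) \<Rightarrow> (nat \<Rightarrow> nat)" where
  "hops n w x = fold (\<lambda>k x. hop n x k) w x"

lemma hops_Nil [simp]: "hops n [] x = x"
  and hops_Cons [simp]: "hops n (k # w) x = hops n w (hop n x k)"
  and hops_append [simp]: "hops n (v @ w) x = hops n w (hops n v x)"
  by (simp_all add: hops_def)

lemma clock_seqs_of_path: "\<omega> \<in> tasep_paths n \<Longrightarrow> k \<le> n \<Longrightarrow> \<omega> k \<in> clock_seqs"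
  by (auto simp: tasep_paths_def)

lemma strict_mono_arrival_times: "\<xi> \<in> clock_seqs \<Longrightarrow> strict_mono (arrival_times \<xi>)"
  using clock_arrivals_arrival_times[of \<xi>] by (simp add: clock_arrivals_def)

lemma ring_site_arrival:
  assumes "\<omega> \<in> tasep_paths n" "k \<le> n"
  shows "ring_site n \<omega> (arrival_times (\<omega> k) j) = k"
  unfolding ring_site_def

proof (intro the_equality)
  fix k' assume k': "k' \<in> {0..n} \<and> (\<exists>j'. arrival_times (\<omega> k) j = arrival_times (\<omega> k') j')"
  with assms show "k' = k"
    unfolding tasep_paths_def distinct_arrivals_def by (cases "k = k'") auto
qed (use assms in auto)

lemma ring_site_le:
  assumes "\<omega> \<in> tasep_paths n" "s \<in> ring_times n \<omega>"
  shows "ring_site n \<omega> s \<le> n"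
  using assms by (auto simp: ring_times_def ring_site_arrival)

lemma finite_arrivals:
  assumes "\<xi> \<in> clock_seqs"
  shows "finite (range (arrival_times \<xi>) \<inter> {a..b})"
proof -
  note * = clock_arrivals_arrival_times[OF assms, unfolded clock_arrivals_def]
  then have sm: "strict_mono (arrival_times \<xi>)" by blast
  obtain l1 l2 where l: "arrival_times \<xi> l1 < a" "b < arrival_times \<xi> l2" using * by meson
  have "range (arrival_times \<xi>) \<inter> {a..b} \<subseteq> arrival_times \<xi> ` {l1..l2}"
  proof
    fix u assume "u \<in> range (arrival_times \<xi>) \<inter> {a..b}"
    then obtain i where i: "u = arrival_times \<xi> i" "a \<le> u" "u \<le> b" by auto
    with l have "arrival_times \<xi> l1 < arrival_times \<xi> i" "arrival_times \<xi> i < arrival_times \<xi> l2" by auto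
    then show "u \<in> arrival_times \<xi> ` {l1..l2}" using sm i by (simp add: strict_mono_less)
  qed
  then show ?thesis by (rule finite_subset) simp
qed

lemma locally_finite_ring_times:
  assumes "\<omega> \<in> tasep_paths n"
  shows "locally_finite_times (ring_times n \<omega>)"
proof
  have eq: "ring_times n \<omega> = (\<Union>k\<in>{0..n}. range (arrival_times (\<omega> k)))"
    by (auto simp: ring_times_def)
  fix a b :: real
  have "ring_times n \<omega> \<inter> {a..b} = (\<Union>k\<in>{0..n}. range (arrival_times (\<omega> k)) \<inter> {a..b})"
    unfolding eq by auto
  also have "finite \<dots>" using clock_seqs_of_path[OF assms] by (intro finite_UN_I finite_arrivals) auto
  finally show "finite (ring_times n \<omega> \<inter> {a..b})" .
  have "clock_arrivals (arrival_times (\<omega> 0))"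
    using clock_seqs_of_path[OF assms, of 0] by (simp add: clock_arrivals_arrival_times)
  then have "\<exists>l. a < arrival_times (\<omega> 0) l" "\<exists>l. arrival_times (\<omega> 0) l < a"
    by (auto simp: clock_arrivals_def)
  then show "\<exists>s\<in>ring_times n \<omega>. a < s" "\<exists>s\<in>ring_times n \<omega>. s < a"
    unfolding eq by force+
qed

lemma finite_ring_times [simp]:
  assumes "\<omega> \<in> tasep_paths n"
  shows "finite (ring_times n \<omega> \<inter> {a..<b})"
proof -
  interpret locally_finite_times "ring_times n \<omega>" using assms by (rule locally_finite_ring_times)
  show ?thesis by simp
qed

text \<open>The indices with jump time in \<open>[0, t)\<close> form an initial segment of the
  naturals, because \<open>jump_times\<close> increases and changes sign at index 0. Iterating over
  this segment visits the rings in sorted order.\<close>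

lemma tasep_cocycle_eq_hops:
  assumes "\<omega> \<in> tasep_paths n"
  shows "tasep_cocycle n t x \<omega> = hops n (ring_word n \<omega> 0 t) x"
proof -
  interpret locally_finite_times "ring_times n \<omega>" using assms by (rule locally_finite_ring_times)
  define \<tau> where "\<tau> = jump_times n \<omega>"
  have \<tau>: "strict_mono \<tau>" "range \<tau> = ring_times n \<omega>" "\<tau> (- 1) < 0" "0 \<le> \<tau> 0"
    using theI'[OF ex1_enumeration] unfolding \<tau>_def jump_times_def ring_times_def by auto
  let ?I = "{i. \<tau> i \<in> {0..<t}}"
  define m where "m = card ?I"
  have nonneg: "0 \<le> \<tau> i \<longleftrightarrow> 0 \<le> i" for i
  proof
    assume "0 \<le> \<tau> i"
    with \<tau>(3) have "\<tau> (- 1) < \<tau> i" by simp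
    then show "0 \<le> i" using \<tau>(1) by (simp add: strict_mono_less)
  next
    assume "0 \<le> i"
    then have "\<tau> 0 \<le> \<tau> i" using \<tau>(1) by (simp add: strict_mono_less_eq)
    with \<tau>(4) show "0 \<le> \<tau> i" by simp
  qed
  have inj: "inj_on \<tau> A" for A using \<tau>(1) by (meson strict_mono_imp_inj_on inj_on_subset subset_UNIV)
  have im: "\<tau> ` ?I = ring_times n \<omega> \<inter> {0..<t}" 
  proof -
    have "\<tau> ` (\<tau> -` A) = range \<tau> \<inter> A" for A by (simp add: Int_commute)
    from this[of "{0..<t}"] show ?thesis unfolding vimage_def \<tau>(2) .
  qed
  then have finI: "finite ?I" by (metis finite_imageD finite_Int(1) inj)
  define I where "I = {p. \<tau> (int p) < t}"
  have I: "?I = int ` I"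
  proof (intro set_eqI iffI)
    fix i assume "i \<in> ?I"
    then show "i \<in> int ` I" by (intro image_eqI[of _ _ "nat i"]) (auto simp: I_def nonneg)
  qed (auto simp: I_def nonneg)
  then have "finite I" using finI by (simp add: finite_image_iff)
  have down: "p \<in> I" if "p \<le> q" "q \<in> I" for p q
  proof -
    have "\<tau> (int p) \<le> \<tau> (int q)" using that \<tau>(1) by (simp add: strict_mono_less_eq)
    with that show ?thesis by (simp add: I_def)
  qed
  have "I = {..<m}"
  proof -
    have "m = card I" unfolding m_def I by (simp add: card_image)
    \<comment> \<open>\<open>I\<close> is finite and downward closed, so the least index outside it
      equals its cardinality.\<close>
    define N where "N = (LEAST p. p \<notin> I)"
    have "N \<notin> I"
      unfolding N_def by (rule LeastI_ex) (rule ex_new_if_finite[OF infinite_UNIV_nat \<open>finite I\<close>])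
    have "p \<in> I" if "p < N" for p using that not_less_Least[of p "\<lambda>p. p \<notin> I"] by (simp add: N_def)
    moreover have "p < N" if "p \<in> I" for p
      using down[of N p] that \<open>N \<notin> I\<close> by (cases "p < N") simp_all
    ultimately have "I = {..<N}" by blast
    with \<open>m = card I\<close> show ?thesis by simp
  qed
  then have "sorted_list_of_set (ring_times n \<omega> \<inter> {0..<t}) = map (\<lambda>p. \<tau> (int p)) [0..<m]"
  proof -
    have "sorted_wrt (<) (map (\<lambda>p. \<tau> (int p)) [0..<m])"
      by (simp add: sorted_wrt_iff_nth_less strict_mono_less[OF \<tau>(1)])
    moreover have "set (map (\<lambda>p. \<tau> (int p)) [0..<m]) = ring_times n \<omega> \<inter> {0..<t}"
      using im unfolding I \<open>I = {..<m}\<close> by (auto simp: image_image atLeast0LessThan)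
    ultimately show ?thesis by (metis sorted_list_of_set.idem_if_sorted_distinct strict_sorted_iff)
  qed
  then have "ring_word n \<omega> 0 t = map (\<lambda>p. jump_index n \<omega> (int p)) [0..<m]"
    by (simp add: ring_word_def sites_of_def jump_index_def ring_site_def \<tau>_def)
  moreover have "tasep_iter n \<omega> x p = hops n (map (\<lambda>p. jump_index n \<omega> (int p)) [0..<p]) x" for p
    by (induction p) auto
  ultimately show ?thesis by (simp add: tasep_cocycle_def m_def \<tau>_def)
qed

lemma tasep_flow_paths:
  assumes "\<omega> \<in> tasep_paths n"
  shows "tasep_flow n t \<omega> \<in> tasep_paths n"
proof -
  have *: "\<omega> k \<in> clock_seqs" if "k \<le> n" for k using assms that by (rule clock_seqs_of_path)
  then have "tasep_flow n t \<omega> \<in> {0..n} \<rightarrow>\<^sub>E clock_seqs"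
    by (auto simp: tasep_flow_def clock_shift)
  moreover have "tasep_flow n t \<omega> \<in> distinct_arrivals n"
    using assms * by (auto simp: tasep_flow_def distinct_arrivals_def tasep_paths_def clock_shift)
  ultimately show ?thesis by (simp add: tasep_paths_def)
qed

lemma ring_times_flow:
  assumes "\<omega> \<in> tasep_paths n"
  shows "ring_times n (tasep_flow n t \<omega>) = (\<lambda>u. u - t) ` ring_times n \<omega>"
proof -
  have eq: "ring_times n \<omega> = (\<Union>k\<in>{0..n}. range (arrival_times (\<omega> k)))" for \<omega>
    by (auto simp: ring_times_def)
  have "range (arrival_times (tasep_flow n t \<omega> k)) = (\<lambda>u. u - t) ` range (arrival_times (\<omega> k))"
    if "k \<in> {0..n}" for k
    using that clock_seqs_of_path[OF assms]
    by (simp add: tasep_flow_def arrival_times_clock_shift_range)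
  then show ?thesis unfolding eq by (simp add: image_UN)
qed

lemma ring_site_flow:
  assumes "\<omega> \<in> tasep_paths n" "s \<in> ring_times n \<omega>"
  shows "ring_site n (tasep_flow n t \<omega>) (s - t) = ring_site n \<omega> s"
proof -
  obtain k j where k: "k \<le> n" and s: "s = arrival_times (\<omega> k) j"
    using assms(2) by (auto simp: ring_times_def)
  have "s - t \<in> (\<lambda>u. u - t) ` range (arrival_times (\<omega> k))" using s by auto
  also have "\<dots> = range (arrival_times (tasep_flow n t \<omega> k))"
    using clock_seqs_of_path[OF assms(1) k] k
    by (simp add: tasep_flow_def arrival_times_clock_shift_range)
  finally obtain j' where "s - t = arrival_times (tasep_flow n t \<omega> k) j'" by auto
  then show ?thesis
    using ring_site_arrival[OF assms(1) k] ring_site_arrival[OF tasep_flow_paths[OF assms(1)] k] s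
    by simp
qed

lemma sorted_list_of_set_image_strict_mono:
  fixes f :: "real \<Rightarrow> real"
  assumes "strict_mono f" "finite A"
  shows "sorted_list_of_set (f ` A) = map f (sorted_list_of_set A)"
proof -
  have "sorted_wrt (<) (map f (sorted_list_of_set A))"
    using assms strict_sorted_list_of_set[of A]
    by (auto simp: sorted_wrt_map strict_mono_less)
  moreover have "set (map f (sorted_list_of_set A)) = f ` A" using assms by simp
  ultimately show ?thesis by (metis sorted_list_of_set.idem_if_sorted_distinct strict_sorted_iff)
qed

text \<open>Translation turns a statement at a shifted path into one at \<open>\<omega>\<close>
  itself, so that all windows below belong to one fixed path. Together with
  \<open>ring_word_append\<close> this takes the place of the cocycle property.\<close>

lemma ring_word_flow:
  assumes "\<omega> \<in> tasep_paths n"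
  shows "ring_word n (tasep_flow n t \<omega>) a b = ring_word n \<omega> (a + t) (b + t)"
proof -
  let ?F = "ring_times n \<omega> \<inter> {a + t..<b + t}"
  have "ring_times n (tasep_flow n t \<omega>) \<inter> {a..<b} = (\<lambda>u. u - t) ` ?F"
    by (force simp: ring_times_flow[OF assms])
  moreover have "sorted_list_of_set ((\<lambda>u. u - t) ` ?F) = map (\<lambda>u. u - t) (sorted_list_of_set ?F)"
    using assms by (intro sorted_list_of_set_image_strict_mono) (auto simp: strict_mono_def)
  ultimately show ?thesis
    using assms by (auto simp: ring_word_def sites_of_def ring_site_flow)
qed

lemma sorted_list_of_set_Un_less:
  fixes A B :: "'a::linorder set"
  assumes "finite A" "finite B" "\<And>a b. a \<in> A \<Longrightarrow> b \<in> B \<Longrightarrow> a < b"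
  shows "sorted_list_of_set (A \<union> B) = sorted_list_of_set A @ sorted_list_of_set B"
proof -
  have "sorted_wrt (<) (sorted_list_of_set A @ sorted_list_of_set B)"
    using assms by (simp add: sorted_wrt_append)
  moreover have "set (sorted_list_of_set A @ sorted_list_of_set B) = A \<union> B" using assms by simp
  ultimately show ?thesis by (metis sorted_list_of_set.idem_if_sorted_distinct strict_sorted_iff)
qed

lemma sites_of_Un:
  assumes "finite A" "finite B" "\<And>a b. a \<in> A \<Longrightarrow> b \<in> B \<Longrightarrow> a < b"
  shows "sites_of n \<omega> (A \<union> B) = sites_of n \<omega> A @ sites_of n \<omega> B"
  using sorted_list_of_set_Un_less[OF assms] by (simp add: sites_of_def)

lemma ring_word_append:
  assumes "\<omega> \<in> tasep_paths n" "a \<le> b" "b \<le> c"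
  shows "ring_word n \<omega> a c = ring_word n \<omega> a b @ ring_word n \<omega> b c"
proof -
  have "ring_times n \<omega> \<inter> {a..<c} = (ring_times n \<omega> \<inter> {a..<b}) \<union> (ring_times n \<omega> \<inter> {b..<c})"
    using assms by auto
  then show ?thesis unfolding ring_word_def by (simp only:) (rule sites_of_Un, use assms in auto)
qed

lemma set_ring_word:
  assumes "\<omega> \<in> tasep_paths n"
  shows "set (ring_word n \<omega> a b) \<subseteq> {0..n}"
  using assms by (auto simp: ring_word_def sites_of_def dest: ring_site_le)

section \<open>Stabilisation of the pullback images\<close>

lemma finite_tasep_states [simp]: "finite (tasep_states n)"
  by (auto simp: tasep_states_def intro: finite_PiE)

lemma tasep_states_nonempty [simp]: "tasep_states n \<noteq> {}"
  by (auto simp: tasep_states_def PiE_eq_empty_iff)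

lemma hop_in_states: "1 \<le> n \<Longrightarrow> k \<le> n \<Longrightarrow> x \<in> tasep_states n \<Longrightarrow> hop n x k \<in> tasep_states n"
  unfolding hop_def tasep_states_def by (auto split: if_splits simp: PiE_iff extensional_def)

lemma hops_in_states:
  "1 \<le> n \<Longrightarrow> set w \<subseteq> {0..n} \<Longrightarrow> x \<in> tasep_states n \<Longrightarrow> hops n w x \<in> tasep_states n"
  by (induction w arbitrary: x) (auto simp: hop_in_states)

text \<open>For \<open>a \<le> b\<close> this is the set
  \<open>\<phi>(b - a, X, \<theta>_a \<omega>)\<close>; two absolute times are easier to split than
  a duration and a shift.\<close>

definition window_image :: "nat \<Rightarrow> (nat \<Rightarrow> int \<Rightarrow> real) \<Rightarrow> real \<Rightarrow> real \<Rightarrow> (nat \<Rightarrow> nat) set" where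
  "window_image n \<omega> a b = hops n (ring_word n \<omega> a b) ` tasep_states n"

lemma tasep_cocycle_flow:
  assumes "\<omega> \<in> tasep_paths n"
  shows "tasep_cocycle n t x (tasep_flow n s \<omega>) = hops n (ring_word n \<omega> s (s + t)) x"
  using assms by (simp add: tasep_cocycle_eq_hops tasep_flow_paths ring_word_flow add.commute)

lemma tasep_attractor_flow:
  assumes "\<omega> \<in> tasep_paths n"
  shows "tasep_attractor n (tasep_flow n t \<omega>) = (\<Inter>s\<in>{0..}. window_image n \<omega> (t - s) t)"
  using assms
  by (simp add: tasep_attractor_def window_image_def tasep_cocycle_flow tasep_flow_paths ring_word_flow)

lemma tasep_attractor_eq:
  assumes "\<omega> \<in> tasep_paths n"
  shows "tasep_attractor n \<omega> = (\<Inter>s\<in>{0..}. window_image n \<omega> (- s) 0)"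
  using assms by (simp add: tasep_attractor_def window_image_def tasep_cocycle_flow)

lemma window_image_subset_states:
  assumes "1 \<le> n" "\<omega> \<in> tasep_paths n"
  shows "window_image n \<omega> a b \<subseteq> tasep_states n"
  using hops_in_states[OF assms(1) set_ring_word[OF assms(2)]] by (auto simp: window_image_def)

lemma window_image_step:
  assumes "\<omega> \<in> tasep_paths n" "a \<le> b" "b \<le> c"
  shows "window_image n \<omega> a c = hops n (ring_word n \<omega> b c) ` window_image n \<omega> a b"
  using assms by (simp add: window_image_def ring_word_append[OF assms] image_image)

text \<open>The rings in \<open>[a, b)\<close> map the state space into itself, so an earlier start
  feeds only a subset of the states into \<open>[b, c)\<close>.\<close>

lemma window_image_mono:
  assumes "1 \<le> n" "\<omega> \<in> tasep_paths n" "a \<le> b" "b \<le> c"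
  shows "window_image n \<omega> a c \<subseteq> window_image n \<omega> b c"
  unfolding window_image_step[OF assms(2-4)] window_image_def[of n \<omega> b c]
  by (rule image_mono[OF window_image_subset_states[OF assms(1,2)]])

text \<open>Take a start time whose image has the least cardinality: every earlier image is
  contained in it and at least as large, hence equal. The intersection is then attained at a finite
  time.\<close>

lemma window_image_stabilises:
  assumes "1 \<le> n" "\<omega> \<in> tasep_paths n"
  obtains a where "a \<le> b" "\<And>a'. a' \<le> a \<Longrightarrow> window_image n \<omega> a' b = window_image n \<omega> a b"
    "(\<Inter>s\<in>{0..}. window_image n \<omega> (b - s) b) = window_image n \<omega> a b"
proof -
  have fin: "finite (window_image n \<omega> a b)" for a by (simp add: window_image_def)
  define m where "m = (LEAST m. \<exists>a\<le>b. card (window_image n \<omega> a b) = m)"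
  have "\<exists>m. \<exists>a\<le>b. card (window_image n \<omega> a b) = m" by blast
  then have "\<exists>a\<le>b. card (window_image n \<omega> a b) = m" unfolding m_def by (rule LeastI_ex)
  then obtain a where a: "a \<le> b" "card (window_image n \<omega> a b) = m" by blast
  have least: "m \<le> card (window_image n \<omega> a' b)" if "a' \<le> b" for a'
    unfolding m_def using that by (intro Least_le) blast
  have eq: "window_image n \<omega> a' b = window_image n \<omega> a b" if "a' \<le> a" for a'
  proof (rule card_seteq[OF fin window_image_mono[OF assms that a(1)]])
    show "card (window_image n \<omega> a b) \<le> card (window_image n \<omega> a' b)"
      unfolding a(2) using that a(1) by (intro least) simp
  qed
  moreover have "(\<Inter>s\<in>{0..}. window_image n \<omega> (b - s) b) = window_image n \<omega> a b"
  proof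
    show "(\<Inter>s\<in>{0..}. window_image n \<omega> (b - s) b) \<subseteq> window_image n \<omega> a b"
      using a(1) by (intro INF_lower2[of "b - a"]) auto
    show "window_image n \<omega> a b \<subseteq> (\<Inter>s\<in>{0..}. window_image n \<omega> (b - s) b)"
    proof (intro INF_greatest)
      fix s :: real assume "s \<in> {0..}"
      then show "window_image n \<omega> a b \<subseteq> window_image n \<omega> (b - s) b"
      proof (cases "b - s \<le> a")
        case True
        then show ?thesis using eq by blast
      next
        case False
        with \<open>s \<in> {0..}\<close> show ?thesis by (intro window_image_mono[OF assms]) auto
      qed
    qed
  qed
  ultimately show thesis using that a(1) by blast
qed

section \<open>Invariance of the pullback limit and convergence to it\<close>

lemma tasep_attractor_invariant:
  assumes "1 \<le> n" "\<omega> \<in> tasep_paths n" "0 \<le> t"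
  shows "(\<lambda>x. tasep_cocycle n t x \<omega>) ` tasep_attractor n \<omega> = tasep_attractor n (tasep_flow n t \<omega>)"
proof -
  obtain a where a: "a \<le> 0" "\<And>a'. a' \<le> a \<Longrightarrow> window_image n \<omega> a' 0 = window_image n \<omega> a 0"
    "(\<Inter>s\<in>{0..}. window_image n \<omega> (0 - s) 0) = window_image n \<omega> a 0"
    using window_image_stabilises[OF assms(1,2)] by blast
  obtain c where c: "c \<le> t" "\<And>a'. a' \<le> c \<Longrightarrow> window_image n \<omega> a' t = window_image n \<omega> c t"
    "(\<Inter>s\<in>{0..}. window_image n \<omega> (t - s) t) = window_image n \<omega> c t"
    using window_image_stabilises[OF assms(1,2)] by blast
  \<comment> \<open>The start \<open>min a c\<close> is early enough for the images at time 0 and at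
    time \<open>t\<close> to have stabilised both, so one concatenation compares the two
    attractors.\<close>
  have "window_image n \<omega> (min a c) t = hops n (ring_word n \<omega> 0 t) ` window_image n \<omega> (min a c) 0"
    using a(1) assms(3) by (intro window_image_step[OF assms(2)]) auto
  then show ?thesis
    using a(2)[of "min a c"] a(3) c(2)[of "min a c"] c(3) assms
    by (simp add: tasep_attractor_eq tasep_attractor_flow tasep_cocycle_eq_hops)
qed

text \<open>By stabilisation the attractor is itself a window image. Nonemptiness is what later
  turns inclusion in a singleton into equality.\<close>

lemma tasep_attractor_subset_nonempty:
  assumes "1 \<le> n" "\<omega> \<in> tasep_paths n"
  shows "tasep_attractor n \<omega> \<subseteq> tasep_states n" "tasep_attractor n \<omega> \<noteq> {}"
proof -
  obtain a where "(\<Inter>s\<in>{0..}. window_image n \<omega> (0 - s) 0) = window_image n \<omega> a 0"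
    by (rule window_image_stabilises[OF assms, of 0])
  then have "tasep_attractor n \<omega> = window_image n \<omega> a 0" using assms by (simp add: tasep_attractor_eq)
  then show "tasep_attractor n \<omega> \<subseteq> tasep_states n" "tasep_attractor n \<omega> \<noteq> {}"
    using window_image_subset_states[OF assms] by (auto simp: window_image_def)
qed

lemma hausdorff_semidist_subset: "C \<subseteq> B \<Longrightarrow> hausdorff_semidist C B = 0"
proof -
  assume "C \<subseteq> B"
  have "(INF b\<in>B. ennreal (discrete_metric.dd c b)) = 0" if "c \<in> C" for c
  proof -
    have "(INF b\<in>B. ennreal (discrete_metric.dd c b)) \<le> ennreal (discrete_metric.dd c c)"
      using that \<open>C \<subseteq> B\<close> by (intro INF_lower) auto
    then show ?thesis by (simp add: discrete_metric.dd_def)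
  qed
  then have "hausdorff_semidist C B \<le> 0"
    unfolding hausdorff_semidist_def by (intro SUP_least) simp
  then show ?thesis by simp
qed

lemma tasep_pullback_convergence:
  assumes "1 \<le> n" "\<omega> \<in> tasep_paths n"
  shows "((\<lambda>t. hausdorff_semidist ((\<lambda>x. tasep_cocycle n t x (tasep_flow n (- t) \<omega>)) ` tasep_states n)
            (tasep_attractor n \<omega>)) \<longlongrightarrow> 0) at_top"
proof -
  obtain a where a: "a \<le> 0" "\<And>a'. a' \<le> a \<Longrightarrow> window_image n \<omega> a' 0 = window_image n \<omega> a 0"
    "(\<Inter>s\<in>{0..}. window_image n \<omega> (0 - s) 0) = window_image n \<omega> a 0"
    using window_image_stabilises[OF assms] by blast
  have "eventually (\<lambda>t. hausdorff_semidist
      ((\<lambda>x. tasep_cocycle n t x (tasep_flow n (- t) \<omega>)) ` tasep_states n) (tasep_attractor n \<omega>) = 0) at_top"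
    using eventually_ge_at_top[of "- a"]
  proof eventually_elim
    case (elim t)
    have "(\<lambda>x. tasep_cocycle n t x (tasep_flow n (- t) \<omega>)) ` tasep_states n = window_image n \<omega> (- t) 0"
      using assms by (simp add: tasep_cocycle_flow window_image_def)
    also have "\<dots> = tasep_attractor n \<omega>"
      using a(2)[of "- t"] a(3) elim assms by (simp add: tasep_attractor_eq)
    finally show ?case by (simp add: hausdorff_semidist_subset)
  qed
  then show ?thesis by (rule tendsto_eventually)
qed

text \<open>Once the image is a single point it stays one. The nonempty set
  \<open>A(\<theta>_t \<omega>)\<close> is contained in \<open>\<phi>(t, X, \<omega>)\<close>, so
  the two coincide for all \<open>t \<ge> b\<close> and the distance is exactly 0 from then
  on.\<close>

lemma tasep_forward_convergence:
  assumes "1 \<le> n" "\<omega> \<in> tasep_paths n" "0 \<le> b" "is_singleton (window_image n \<omega> 0 b)"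
  shows "((\<lambda>t. hausdorff_semidist ((\<lambda>x. tasep_cocycle n t x \<omega>) ` tasep_states n)
            (tasep_attractor n (tasep_flow n t \<omega>))) \<longlongrightarrow> 0) at_top"
proof -
  have "eventually (\<lambda>t. hausdorff_semidist
      ((\<lambda>x. tasep_cocycle n t x \<omega>) ` tasep_states n) (tasep_attractor n (tasep_flow n t \<omega>)) = 0) at_top"
    using eventually_ge_at_top[of b]
  proof eventually_elim
    case (elim t)
    have im: "(\<lambda>x. tasep_cocycle n t x \<omega>) ` tasep_states n = window_image n \<omega> 0 t"
      using assms by (simp add: tasep_cocycle_eq_hops window_image_def)
    obtain z where z: "window_image n \<omega> 0 b = {z}" using assms(4) by (auto elim: is_singletonE)
    have "window_image n \<omega> 0 t = {hops n (ring_word n \<omega> b t) z}"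
      using window_image_step[OF assms(2,3) elim] z by simp
    moreover have "tasep_attractor n (tasep_flow n t \<omega>) \<subseteq> window_image n \<omega> 0 t"
      using INF_lower[of t "{0..}" "\<lambda>s. window_image n \<omega> (t - s) t"] elim assms(3)
      by (simp add: tasep_attractor_flow[OF assms(2)])
    moreover have "tasep_attractor n (tasep_flow n t \<omega>) \<noteq> {}"
      using tasep_attractor_subset_nonempty tasep_flow_paths assms by blast
    ultimately have "window_image n \<omega> 0 t \<subseteq> tasep_attractor n (tasep_flow n t \<omega>)" by auto
    then show ?case unfolding im by (rule hausdorff_semidist_subset)
  qed
  then show ?thesis by (rule tendsto_eventually)
qed

lemma tasep_attractor_singleton:
  assumes "1 \<le> n" "\<omega> \<in> tasep_paths n" "a \<le> 0" "is_singleton (window_image n \<omega> a 0)"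
  shows "is_singleton (tasep_attractor n \<omega>)"
proof -
  have "tasep_attractor n \<omega> \<subseteq> window_image n \<omega> a 0"
    using INF_lower[of "- a" "{0..}" "\<lambda>s. window_image n \<omega> (- s) 0"] assms(3)
    by (simp add: tasep_attractor_eq[OF assms(2)])
  then show ?thesis using tasep_attractor_subset_nonempty[OF assms(1,2)] assms(4)
    by (auto simp: is_singleton_def subset_singleton_iff)
qed

section \<open>Counts of a renewal process with exponential gaps\<close>

definition exp_gaps :: "real \<Rightarrow> (nat \<Rightarrow> real) measure" where
  "exp_gaps r = (\<Pi>\<^sub>M i\<in>UNIV. density lborel (exponential_density r))"

definition poisson_prob :: "real \<Rightarrow> nat \<Rightarrow> real" where
  "poisson_prob \<mu> c = \<mu> ^ c / fact c * exp (- \<mu>)"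

text \<open>
  The arrivals are the partial sums \<open>\<omega> 0 + \<dots> + \<omega> l\<close>. The list \<open>cs\<close> gives the number of
  arrivals in \<open>[0, d)\<close>, then in \<open>[d, d + 1)\<close>, \<open>[d + 1, d + 2)\<close>, and so on.
\<close>

definition renewal_counts :: "real \<Rightarrow> nat list \<Rightarrow> (nat \<Rightarrow> real) \<Rightarrow> bool" where
  "renewal_counts d cs \<omega> \<longleftrightarrow> (\<forall>i. 0 \<le> \<omega> i) \<and>
     (\<forall>m<length cs. (\<Sum>i<sum_list (take (Suc m) cs). \<omega> i) < d + real m \<and>
        d + real m \<le> (\<Sum>i<Suc (sum_list (take (Suc m) cs)). \<omega> i))"

lemma sets_exp_gaps [measurable_cong]: "sets (exp_gaps r) = sets (\<Pi>\<^sub>M i\<in>UNIV. borel)"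
  unfolding exp_gaps_def by (intro sets_PiM_cong) auto

lemma space_exp_gaps [simp]: "space (exp_gaps r) = UNIV"
  by (auto simp: exp_gaps_def space_PiM)

lemma prob_space_exp_gaps: "0 < r \<Longrightarrow> prob_space (exp_gaps r)"
  unfolding exp_gaps_def by (intro prob_space_PiM prob_space_exponential_density)

lemma measurable_renewal_counts [measurable]:
  "Measurable.pred (exp_gaps r) (renewal_counts d cs)"
  unfolding renewal_counts_def by measurable

lemma measurable_case_nat_gaps [measurable]:
  "(\<lambda>(x, \<omega>). case_nat x \<omega>) \<in> measurable (borel \<Otimes>\<^sub>M exp_gaps r) (exp_gaps r)"
proof -
  have "(\<lambda>(x, \<omega>). case_nat x \<omega>) \<in>
      measurable (borel \<Otimes>\<^sub>M (\<Pi>\<^sub>M i\<in>UNIV. borel)) (\<Pi>\<^sub>M i\<in>UNIV::nat set. borel :: real measure)"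
    by measurable
  then show ?thesis
    by (simp cong: measurable_cong_sets sets_pair_measure_cong add: sets_exp_gaps)
qed

text \<open>Conditioning on the first gap: by \<open>PiM_iter\<close> the infinite product is the
  law of a gap \<open>x\<close> put in front of an independent sequence with the same product
  law.\<close>

lemma emeasure_exp_gaps_case_nat:
  assumes "0 < r" and A [measurable]: "Measurable.pred (exp_gaps r) P"
  shows "emeasure (exp_gaps r) {\<omega>. P \<omega>} =
    (\<integral>\<^sup>+x. ennreal (exponential_density r x) * emeasure (exp_gaps r) {\<omega>. P (case_nat x \<omega>)} \<partial>lborel)"
proof -
  let ?M = "density lborel (\<lambda>x. ennreal (exponential_density r x))"
  interpret M: prob_space ?M using assms(1) by (rule prob_space_exponential_density)
  interpret sequence_space ?M ..
  have S: "S = exp_gaps r" by (simp add: exp_gaps_def)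
  have [measurable]: "(\<lambda>(x, \<omega>). case_nat x \<omega>) \<in> measurable (?M \<Otimes>\<^sub>M S) S"
    by measurable
  have [measurable]: "Measurable.pred S P" using A by (simp add: S)
  have [simp]: "{\<omega>. P \<omega>} \<in> sets S" using A by (simp add: S pred_def)
  have "emeasure S {\<omega>\<in>space S. P \<omega>} =
      emeasure (distr (?M \<Otimes>\<^sub>M S) S (\<lambda>(x, \<omega>). case_nat x \<omega>)) {\<omega>\<in>space S. P \<omega>}"
    by (simp only: PiM_iter)
  also have "\<dots> = emeasure (?M \<Otimes>\<^sub>M S) {z\<in>space (?M \<Otimes>\<^sub>M S). P (case_nat (fst z) (snd z))}"
    by (subst emeasure_distr) (auto intro!: arg_cong2[where f = emeasure] simp: space_pair_measure space_PiM)
  also have "\<dots> = (\<integral>\<^sup>+x. emeasure S {\<omega>\<in>space S. P (case_nat x \<omega>)} \<partial>?M)"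
    by (subst P.emeasure_pair_measure_alt)
      (auto intro!: nn_integral_cong arg_cong2[where f = emeasure] simp: space_pair_measure)
  also have "\<dots> = (\<integral>\<^sup>+x. ennreal (exponential_density r x) * emeasure S {\<omega>\<in>space S. P (case_nat x \<omega>)} \<partial>lborel)"
    by (subst nn_integral_density) auto
  finally show ?thesis by (simp add: S)
qed

lemma renewal_counts_0:
  assumes "0 < d"
  shows "renewal_counts d (0 # cs) (case_nat x \<omega>) \<longleftrightarrow> d \<le> x \<and> renewal_counts 1 cs (case_nat (x - d) \<omega>)"
proof -
  \<comment> \<open>Moving the origin to \<open>d\<close> lowers every partial sum by
    \<open>d\<close> except the empty one, which stays 0. The comparison \<open>lt\<close> survives
    this exception because both of its bounds are positive.\<close>
  have sum: "(\<Sum>i<C. case_nat x \<omega> i) = (if C = 0 then 0 else d + (\<Sum>i<C. case_nat (x - d) \<omega> i))" for C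
    by (cases C) (simp_all add: sum.lessThan_Suc_shift del: sum.lessThan_Suc)
  have ex: "(\<forall>m<Suc k. Q m) \<longleftrightarrow> Q 0 \<and> (\<forall>m<k. Q (Suc m))" for k and Q :: "nat \<Rightarrow> bool"
    by (auto simp: less_Suc_eq_0_disj)
  have all: "(\<forall>i. 0 \<le> case_nat x \<omega> i) \<longleftrightarrow> 0 \<le> x \<and> (\<forall>i. 0 \<le> \<omega> i)" for x
    by (auto split: nat.split)
  have lt: "(\<Sum>i<C. case_nat x \<omega> i) < d + real (Suc m) \<longleftrightarrow> (\<Sum>i<C. case_nat (x - d) \<omega> i) < 1 + real m" for C m
    using assms by (cases "C = 0") (simp_all add: sum)
  have le: "d + real (Suc m) \<le> (\<Sum>i<Suc C. case_nat x \<omega> i) \<longleftrightarrow>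
      1 + real m \<le> (\<Sum>i<Suc C. case_nat (x - d) \<omega> i)" for C m
    by (simp only: sum) simp
  have "(\<forall>m<length (0 # cs). (\<Sum>i<sum_list (take (Suc m) (0 # cs)). case_nat x \<omega> i) < d + real m \<and>
          d + real m \<le> (\<Sum>i<Suc (sum_list (take (Suc m) (0 # cs))). case_nat x \<omega> i)) \<longleftrightarrow>
     d \<le> x \<and> (\<forall>m<length cs. (\<Sum>i<sum_list (take (Suc m) cs). case_nat (x - d) \<omega> i) < 1 + real m \<and>
          1 + real m \<le> (\<Sum>i<Suc (sum_list (take (Suc m) cs)). case_nat (x - d) \<omega> i))"
    unfolding length_Cons ex lt le using assms 
    by (simp add: take_Suc_Cons lt le of_nat_Suc[of 0] del: sum.lessThan_Suc of_nat_Suc)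
  then show ?thesis using assms unfolding renewal_counts_def all by auto
qed

lemma renewal_counts_Suc:
  assumes "0 < d"
  shows "renewal_counts d (Suc c # cs) (case_nat x \<omega>) \<longleftrightarrow> 0 \<le> x \<and> x < d \<and> renewal_counts (d - x) (c # cs) \<omega>"
proof -
  have sum: "(\<Sum>i<Suc C. case_nat x \<omega> i) = x + (\<Sum>i<C. \<omega> i)" for C
    by (simp add: sum.lessThan_Suc_shift del: sum.lessThan_Suc)
  have all: "(\<forall>i. 0 \<le> case_nat x \<omega> i) \<longleftrightarrow> 0 \<le> x \<and> (\<forall>i. 0 \<le> \<omega> i)" for x
    by (auto split: nat.split)
  have take: "sum_list (take (Suc m) (Suc c # cs)) = Suc (sum_list (take (Suc m) (c # cs)))" for m
    by simp
  have "x < d" if "\<forall>i. 0 \<le> \<omega> i" "x + (\<Sum>i<c. \<omega> i) < d"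
  proof -
    have "0 \<le> (\<Sum>i<c. \<omega> i)" using that by (intro sum_nonneg) auto
    with that show ?thesis by simp
  qed
  then show ?thesis
    unfolding renewal_counts_def all take sum
    by (force simp del: sum.lessThan_Suc simp: algebra_simps)
qed

lemma poisson_prob_nonneg: "0 \<le> \<mu> \<Longrightarrow> 0 \<le> poisson_prob \<mu> c"
  by (simp add: poisson_prob_def)

lemma poisson_prob_pos: "0 < \<mu> \<Longrightarrow> 0 < poisson_prob \<mu> c"
  by (simp add: poisson_prob_def)

text \<open>Convolution step of the Poisson law, conditioning on the first arrival at
  \<open>x\<close>: the exponentials in \<open>x\<close> and in \<open>d - x\<close> multiply to the
  constant \<open>exp (- (r * d))\<close>, which leaves a power of \<open>d - x\<close> to
  integrate.\<close>

lemma nn_integral_exponential_poisson_prob: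
  assumes "0 < r" "0 < d"
  shows "(\<integral>\<^sup>+x. ennreal (exponential_density r x) *
      (if 0 \<le> x \<and> x < d then ennreal (poisson_prob (r * (d - x)) c) else 0) \<partial>lborel) =
    ennreal (poisson_prob (r * d) (Suc c))"
proof -
  \<comment> \<open>An antiderivative normalised to vanish at \<open>d\<close>; then
    \<open>- F 0\<close> is the Poisson weight of \<open>Suc c\<close>.\<close>
  define F where "F x = - exp (- (r * d)) * r ^ Suc c * (d - x) ^ Suc c / fact (Suc c)" for x
  have "(\<integral>\<^sup>+x. ennreal (exponential_density r x) *
      (if 0 \<le> x \<and> x < d then ennreal (poisson_prob (r * (d - x)) c) else 0) \<partial>lborel) =
    (\<integral>\<^sup>+x. ennreal (exp (- (r * d)) * r ^ Suc c * (d - x) ^ c / fact c) * indicator {0..d} x \<partial>lborel)"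
  proof (rule nn_integral_cong_AE)
    have eq: "r * exp (- x * r) * poisson_prob (r * (d - x)) c =
        exp (- (r * d)) * r ^ Suc c * (d - x) ^ c / fact c" for x
    proof -
      have "exp (- x * r) * exp (- (r * (d - x))) = exp (- (r * d))"
        by (simp add: exp_add[symmetric] algebra_simps)
      then show ?thesis by (simp add: poisson_prob_def power_mult_distrib mult_ac)
    qed
    \<comment> \<open>The point \<open>d\<close>, which lies in \<open>{0..d}\<close> but not in
      \<open>[0, d)\<close>, is negligible.\<close>
    have "AE x in lborel. x \<noteq> d" by (rule AE_lborel_singleton)
    then show "AE x in lborel. ennreal (exponential_density r x) *
      (if 0 \<le> x \<and> x < d then ennreal (poisson_prob (r * (d - x)) c) else 0) =
      ennreal (exp (- (r * d)) * r ^ Suc c * (d - x) ^ c / fact c) * indicator {0..d} x"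
    proof eventually_elim
      case (elim x)
      show ?case
      proof (cases "0 \<le> x \<and> x < d")
        case True
        then show ?thesis using assms eq[of x]
          by (simp add: exponential_density_def ennreal_mult'[symmetric] poisson_prob_nonneg del: mult_minus_left)
      qed (use elim in \<open>auto simp: indicator_def\<close>)
    qed
  qed
  also have "\<dots> = ennreal (F d - F 0)"
  proof (rule nn_integral_FTC_Icc)
    fix x :: real assume x: "x \<in> {0..d}"
    have "(F has_real_derivative
        - exp (- (r * d)) * r ^ Suc c * (real (Suc c) * (d - x) ^ c * (- 1)) / fact (Suc c)) (at x)"
      unfolding F_def by (rule derivative_eq_intros refl | simp)+
    also have "- exp (- (r * d)) * r ^ Suc c * (real (Suc c) * (d - x) ^ c * (- 1)) / fact (Suc c) =
        exp (- (r * d)) * r ^ Suc c * (d - x) ^ c / fact c"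
      by (simp add: divide_simps)
    finally show "(F has_real_derivative exp (- (r * d)) * r ^ Suc c * (d - x) ^ c / fact c) (at x)" .
    show "0 \<le> exp (- (r * d)) * r ^ Suc c * (d - x) ^ c / fact c"
      using assms x by simp
  qed (use assms in auto)
  also have "F d - F 0 = poisson_prob (r * d) (Suc c)"
    by (simp add: F_def poisson_prob_def power_mult_distrib)
  finally show ?thesis .
qed

text \<open>Memorylessness: for \<open>x \<ge> 0\<close> the density at \<open>d + x\<close> is
  \<open>exp (- (r * d))\<close> times the density at \<open>x\<close>.\<close>

lemma nn_integral_exponential_shift:
  assumes "0 < r" "0 < d" and [measurable]: "g \<in> borel_measurable borel"
  shows "(\<integral>\<^sup>+x. ennreal (exponential_density r x) * (if d \<le> x then g (x - d) else 0) \<partial>lborel) =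
    ennreal (exp (- (r * d))) * (\<integral>\<^sup>+x. ennreal (exponential_density r x) * g x \<partial>lborel)"
proof -
  have "(\<integral>\<^sup>+x. ennreal (exponential_density r x) * (if d \<le> x then g (x - d) else 0) \<partial>lborel) =
    (\<integral>\<^sup>+x. ennreal (exponential_density r (d + x)) * (if 0 \<le> x then g x else 0) \<partial>lborel)"
    by (subst nn_integral_real_affine[where c = 1 and t = d]) (auto intro!: nn_integral_cong)
  also have "\<dots> = (\<integral>\<^sup>+x. ennreal (exp (- (r * d))) * (ennreal (exponential_density r x) * g x) \<partial>lborel)"
  proof (rule nn_integral_cong)
    fix x :: real
    have "exp (- (d + x) * r) = exp (- (r * d)) * exp (- x * r)"
      by (simp add: exp_add[symmetric] algebra_simps)
    then show "ennreal (exponential_density r (d + x)) * (if 0 \<le> x then g x else 0) =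
        ennreal (exp (- (r * d))) * (ennreal (exponential_density r x) * g x)"
      using assms by (auto simp: exponential_density_def ennreal_mult mult_ac)
  qed
  also have "\<dots> = ennreal (exp (- (r * d))) * (\<integral>\<^sup>+x. ennreal (exponential_density r x) * g x \<partial>lborel)"
    by (rule nn_integral_cmult) simp
  finally show ?thesis .
qed

lemma AE_exp_gaps_nonneg: "0 < r \<Longrightarrow> AE \<omega> in exp_gaps r. \<forall>i. 0 \<le> \<omega> i"
proof -
  assume "0 < r"
  then interpret prob_space "density lborel (exponential_density r)" by (rule prob_space_exponential_density)
  interpret product_prob_space "\<lambda>_::nat. density lborel (exponential_density r)" UNIV ..
  have "AE x in density lborel (exponential_density r). 0 \<le> x"
    by (subst AE_density) (auto simp: exponential_density_def)
  then have "AE \<omega> in exp_gaps r. 0 \<le> \<omega> i" for i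
    unfolding exp_gaps_def by (intro AE_component) auto
  then show ?thesis by (simp add: AE_all_countable)
qed

lemma emeasure_renewal_counts_Nil:
  assumes "0 < r"
  shows "emeasure (exp_gaps r) {\<omega>. renewal_counts d [] \<omega>} = 1"
proof -
  interpret prob_space "exp_gaps r" using assms by (rule prob_space_exp_gaps)
  have "{\<omega>. renewal_counts d [] \<omega>} \<in> sets (exp_gaps r)"
    using measurable_renewal_counts by (simp add: pred_def)
  moreover have "AE \<omega> in exp_gaps r. renewal_counts d [] \<omega>"
    using AE_exp_gaps_nonneg[OF assms] by (simp add: renewal_counts_def)
  ultimately show ?thesis by (intro emeasure_eq_1_AE) auto
qed

text \<open>
  By memorylessness the counts in disjoint windows are independent Poisson variables: after an
  empty rest \<open>[0, d)\<close> of a window the next gap restarts at \<open>d\<close>, and after an arrival at \<open>x < d\<close>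
  the rest \<open>[x, d)\<close> of the window is left.
\<close>

lemma emeasure_renewal_counts_Cons:
  assumes "0 < r" "0 < d"
  shows "emeasure (exp_gaps r) {\<omega>. renewal_counts d (c # cs) \<omega>} =
    ennreal (poisson_prob (r * d) c * (\<Prod>c'\<leftarrow>cs. poisson_prob r c'))"
  using assms(2)
proof (induction cs arbitrary: c d)
  let ?e = "\<lambda>P. emeasure (exp_gaps r) {\<omega>. P \<omega>}"
  \<comment> \<open>Inner induction on the count of the first window, with the probability
    \<open>p\<close> of the later windows kept abstract. The length \<open>d\<close> varies because
    each arrival shortens the window, whereas the later windows always start from length 1.\<close>
  have step: "?e (renewal_counts d (c # cs)) = ennreal (poisson_prob (r * d) c * p)"
    if "0 < d" and rest: "?e (renewal_counts 1 cs) = ennreal p" and "0 \<le> p" for d c cs p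
    using \<open>0 < d\<close>
  proof (induction c arbitrary: d)
    case 0
    \<comment> \<open>Conditional probability of the later windows when the residual gap at the end
      of the first window is \<open>x\<close>. Integrated against the density it gives the
      unconditional probability again.\<close>
    define g where "g x = ?e (\<lambda>\<omega>. renewal_counts 1 cs (case_nat x \<omega>))" for x
    have [measurable]: "g \<in> borel_measurable borel"
    proof -
      interpret prob_space "exp_gaps r" using \<open>0 < r\<close> by (rule prob_space_exp_gaps)
      let ?Q = "(\<lambda>(x, \<omega>). case_nat x \<omega>) -` {\<omega>. renewal_counts 1 cs \<omega>} \<inter> space (borel \<Otimes>\<^sub>M exp_gaps r)"
      have "{\<omega>. renewal_counts 1 cs \<omega>} \<in> sets (exp_gaps r)"
        using measurable_renewal_counts by (simp add: pred_def)
      then have "?Q \<in> sets (borel \<Otimes>\<^sub>M exp_gaps r)"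
        by (rule measurable_sets[OF measurable_case_nat_gaps])
      from measurable_emeasure_Pair[OF this]
      have "(\<lambda>x. emeasure (exp_gaps r) (Pair x -` ?Q)) \<in> borel_measurable borel" .
      moreover have "Pair x -` ?Q = {\<omega>. renewal_counts 1 cs (case_nat x \<omega>)}" for x
        by (auto simp: space_pair_measure)
      ultimately have "(\<lambda>x. emeasure (exp_gaps r) {\<omega>. renewal_counts 1 cs (case_nat x \<omega>)}) \<in> borel_measurable borel"
        by simp
      then show ?thesis by (simp add: g_def[abs_def])
    qed
    have "?e (renewal_counts d (0 # cs)) =
        (\<integral>\<^sup>+x. ennreal (exponential_density r x) * (if d \<le> x then g (x - d) else 0) \<partial>lborel)"
      unfolding emeasure_exp_gaps_case_nat[OF \<open>0 < r\<close> measurable_renewal_counts]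
        renewal_counts_0[OF \<open>0 < d\<close>] g_def
      by (intro nn_integral_cong) auto
    also have "\<dots> = ennreal (exp (- (r * d))) * (\<integral>\<^sup>+x. ennreal (exponential_density r x) * g x \<partial>lborel)"
      by (rule nn_integral_exponential_shift) fact+
    also have "(\<integral>\<^sup>+x. ennreal (exponential_density r x) * g x \<partial>lborel) = ?e (renewal_counts 1 cs)"
      unfolding emeasure_exp_gaps_case_nat[OF \<open>0 < r\<close> measurable_renewal_counts] g_def ..
    finally show ?case
      using \<open>0 \<le> p\<close> by (simp add: rest poisson_prob_def ennreal_mult)
  next
    case (Suc c)
    have "?e (renewal_counts d (Suc c # cs)) =
        (\<integral>\<^sup>+x. ennreal (exponential_density r x) *
          (if 0 \<le> x \<and> x < d then ennreal (poisson_prob (r * (d - x)) c) else 0) * ennreal p \<partial>lborel)"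
      unfolding emeasure_exp_gaps_case_nat[OF \<open>0 < r\<close> measurable_renewal_counts]
        renewal_counts_Suc[OF \<open>0 < d\<close>]
      using Suc.IH \<open>0 \<le> p\<close> \<open>0 < r\<close>
      by (intro nn_integral_cong) (auto simp: ennreal_mult poisson_prob_nonneg mult.assoc)
    also have "\<dots> = ennreal (poisson_prob (r * d) (Suc c)) * ennreal p"
      unfolding nn_integral_exponential_poisson_prob[OF \<open>0 < r\<close> \<open>0 < d\<close>, symmetric]
      unfolding poisson_prob_def by (rule nn_integral_multc) measurable
    also have "\<dots> = ennreal (poisson_prob (r * d) (Suc c) * p)"
      using \<open>0 \<le> p\<close> \<open>0 < r\<close> \<open>0 < d\<close> by (intro ennreal_mult[symmetric] poisson_prob_nonneg) auto
    finally show ?case .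
  qed
  {
    case Nil
    then show ?case
      using emeasure_renewal_counts_Nil[OF \<open>0 < r\<close>] by (subst step[where p = 1]) simp_all
  next
    case (Cons c' cs)
    have "0 \<le> (\<Prod>c'\<leftarrow>cs. poisson_prob r c')"
      using \<open>0 < r\<close> by (intro prod_list_nonneg) (auto simp: poisson_prob_nonneg)
    then show ?case
      using Cons \<open>0 < r\<close> Cons.IH[of 1 c']
      by (subst step[where p = "poisson_prob r c' * (\<Prod>c'\<leftarrow>cs. poisson_prob r c')"])
        (simp_all add: poisson_prob_nonneg)
  }
qed

lemma emeasure_renewal_counts:
  assumes "0 < r"
  shows "emeasure (exp_gaps r) {\<omega>. renewal_counts 1 cs \<omega>} = ennreal (\<Prod>c\<leftarrow>cs. poisson_prob r c)"
proof (cases cs)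
  case Nil
  then show ?thesis using emeasure_renewal_counts_Nil[OF assms] by simp
next
  case (Cons c cs)
  then show ?thesis using emeasure_renewal_counts_Cons[OF assms zero_less_one, where c = c and cs = cs] by simp
qed

section \<open>The law of a single clock\<close>

lemma emeasure_exponential_atMost:
  assumes "0 < r" "0 \<le> K"
  shows "emeasure (density lborel (exponential_density r)) {..K} = ennreal (1 - exp (- K * r))"
proof -
  interpret prob_space "density lborel (exponential_density r)"
    using assms(1) by (rule prob_space_exponential_density)
  have "distributed (density lborel (exponential_density r)) lborel (\<lambda>x. x) (exponential_density r)"
    by (simp add: distributed_def distr_id2)
  from exponential_distributedD_le[OF this assms(2,1)] show ?thesis
    by (simp add: emeasure_eq_measure atMost_def)
qed

lemma AE_exponential_pos: "AE x in density lborel (exponential_density r). 0 < x"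
proof -
  have "AE x in lborel. x \<noteq> (0 :: real)" by (rule AE_lborel_singleton)
  then have "AE x in lborel. 0 < exponential_density r x \<longrightarrow> 0 < x"
    by eventually_elim (auto simp: exponential_density_def)
  then show ?thesis by (subst AE_density) auto
qed

definition gap_measure :: "real \<Rightarrow> (int \<Rightarrow> real) measure" where
  "gap_measure r = (\<Pi>\<^sub>M i\<in>UNIV. density lborel (exponential_density r))"

lemma sets_gap_measure [measurable_cong]: "sets (gap_measure r) = sets (\<Pi>\<^sub>M i\<in>UNIV. borel)"
  unfolding gap_measure_def by (intro sets_PiM_cong) auto

lemma space_gap_measure [simp]: "space (gap_measure r) = UNIV"
  by (auto simp: gap_measure_def space_PiM)

lemma prob_space_gap_measure: "0 < r \<Longrightarrow> prob_space (gap_measure r)"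
  unfolding gap_measure_def by (intro prob_space_PiM prob_space_exponential_density)

lemma AE_gaps_pos:
  assumes "0 < r"
  shows "AE \<xi> in gap_measure r. \<forall>i. 0 < \<xi> i"
proof -
  interpret prob_space "density lborel (exponential_density r)"
    using assms by (rule prob_space_exponential_density)
  interpret product_prob_space "\<lambda>_::int. density lborel (exponential_density r)" UNIV ..
  have "AE \<xi> in gap_measure r. 0 < \<xi> i" for i
    unfolding gap_measure_def by (intro AE_component AE_exponential_pos) auto
  then show ?thesis by (simp add: AE_all_countable)
qed

text \<open>Serves to make the partial sums diverge: a sum of positive gaps exceeds \<open>K\<close>
  as soon as one gap does. That the first \<open>M\<close> selected gaps are all at most
  \<open>K\<close> has probability \<open>q ^ M\<close> with \<open>q < 1\<close>.\<close>

lemma AE_gaps_unbounded: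
  fixes e :: "nat \<Rightarrow> int"
  assumes "0 < r" "inj e"
  shows "AE \<xi> in gap_measure r. \<forall>K::nat. \<exists>i. real K < \<xi> (e i)"
proof -
  interpret prob_space "density lborel (exponential_density r)"
    using assms(1) by (rule prob_space_exponential_density)
  interpret product_prob_space "\<lambda>_::int. density lborel (exponential_density r)" UNIV ..
  have "AE \<xi> in gap_measure r. \<exists>i. real K < \<xi> (e i)" for K :: nat
  proof -
    define q where "q = 1 - exp (- (real K * r))"
    have q: "0 \<le> q" "q < 1" using assms(1) by (simp_all add: q_def)
    let ?N = "{\<xi>. \<forall>i. \<xi> (e i) \<le> real K}"
    have N: "?N \<in> sets (gap_measure r)"
    proof -
      have "{\<xi>\<in>space (gap_measure r). \<forall>i. \<xi> (e i) \<le> real K} \<in> sets (gap_measure r)" by measurable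
      then show ?thesis by simp
    qed
    have le: "emeasure (gap_measure r) ?N \<le> ennreal (q ^ M)" for M
    proof -
      have "?N \<subseteq> {\<xi>\<in>space (gap_measure r). \<forall>i\<in>e ` {..<M}. \<xi> i \<in> {..real K}}" by auto
      then have "emeasure (gap_measure r) ?N \<le>
          emeasure (gap_measure r) {\<xi>\<in>space (gap_measure r). \<forall>i\<in>e ` {..<M}. \<xi> i \<in> {..real K}}"
        by (intro emeasure_mono) measurable
      also have "\<dots> = (\<Prod>i\<in>e ` {..<M}. emeasure (density lborel (exponential_density r)) {..real K})"
        unfolding gap_measure_def by (intro emeasure_PiM_Collect) auto
      also have "\<dots> = ennreal (q ^ M)"
        using assms q by (simp add: emeasure_exponential_atMost q_def[symmetric] card_image inj_on_def ennreal_power)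
      finally show ?thesis .
    qed
    have "(\<lambda>M. ennreal (q ^ M)) \<longlonglongrightarrow> ennreal 0"
      using q by (intro tendsto_ennrealI LIMSEQ_power_zero) auto
    then have "emeasure (gap_measure r) ?N \<le> ennreal 0"
      using le by (intro LIMSEQ_le_const) auto
    then have "?N \<in> null_sets (gap_measure r)" using N by auto
    then show ?thesis by (rule AE_I') (auto simp: not_less)
  qed
  then show ?thesis by (simp add: AE_all_countable)
qed

text \<open>Natural thresholds turn divergence into a countable condition, from which the
  measurability of \<open>clock_seqs\<close> follows.\<close>

lemma filterlim_at_top_sequentially_iff:
  fixes f :: "nat \<Rightarrow> real"
  shows "filterlim f at_top sequentially \<longleftrightarrow> (\<forall>K::nat. \<exists>N. \<forall>m\<ge>N. real K \<le> f m)"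
  unfolding filterlim_at_top eventually_sequentially
proof (intro iffI allI)
  fix Z assume *: "\<forall>K::nat. \<exists>N. \<forall>m\<ge>N. real K \<le> f m"
  obtain K :: nat where "Z \<le> real K" using real_arch_simple by blast
  with * show "\<exists>N. \<forall>m\<ge>N. Z \<le> f m" by (meson order_trans)
qed blast

lemma clock_seqs_measurable: "clock_seqs \<in> sets (gap_measure r)"
proof -
  have "{\<xi>\<in>space (gap_measure r). \<xi> 0 \<ge> 0 \<and> (\<forall>i. i \<noteq> 0 \<longrightarrow> \<xi> i > 0) \<and>
     (\<forall>K::nat. \<exists>N::nat. \<forall>m\<ge>N. real K \<le> (\<Sum>i=0..m. \<xi> (int i))) \<and>
     (\<forall>K::nat. \<exists>N::nat. \<forall>m\<ge>N. real K \<le> (\<Sum>i=1..m. \<xi> (- int i)))} \<in> sets (gap_measure r)"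
    by measurable
  then show ?thesis by (simp add: clock_seqs_def filterlim_at_top_sequentially_iff)
qed

lemma AE_clock_seqs:
  assumes "0 < r"
  shows "AE \<xi> in gap_measure r. \<xi> \<in> clock_seqs"
proof -
  have "inj (\<lambda>i. - int (Suc i))" by (simp add: inj_def)
  then have "AE \<xi> in gap_measure r. \<forall>K::nat. \<exists>i. real K < \<xi> (- int (Suc i))"
    by (rule AE_gaps_unbounded[OF assms])
  with AE_gaps_pos[OF assms] AE_gaps_unbounded[OF assms inj_of_nat] show ?thesis
  proof eventually_elim
    case (elim \<xi>)
    have "\<exists>N. \<forall>m\<ge>N. real K \<le> (\<Sum>i=0..m. \<xi> (int i))" for K :: nat
    proof -
      obtain j where "real K < \<xi> (int j)" using elim(2) by blast
      moreover have "\<xi> (int j) \<le> (\<Sum>i=0..m. \<xi> (int i))" if "j \<le> m" for m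
        using that elim(1) by (intro member_le_sum) (auto intro: less_imp_le)
      ultimately show ?thesis by (meson less_imp_le order_trans)
    qed
    moreover have "\<exists>N. \<forall>m\<ge>N. real K \<le> (\<Sum>i=1..m. \<xi> (- int i))" for K :: nat
    proof -
      obtain j where "real K < \<xi> (- int (Suc j))" using elim(3) by blast
      moreover have "\<xi> (- int (Suc j)) \<le> (\<Sum>i=1..m. \<xi> (- int i))" if "Suc j \<le> m" for m
        using that elim(1) by (intro member_le_sum[of _ _ "\<lambda>i. \<xi> (- int i)"]) (auto intro: less_imp_le)
      ultimately show ?thesis by (meson less_imp_le order_trans)
    qed
    ultimately show ?case
      using elim(1) by (simp add: clock_seqs_def filterlim_at_top_sequentially_iff less_imp_le)
  qed
qed

lemma clock_space_eq: "clock_space r = restrict_space (gap_measure r) clock_seqs"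
  by (simp add: clock_space_def gap_measure_def)

lemma space_clock_space [simp]: "space (clock_space r) = clock_seqs"
  by (simp add: clock_space_eq space_restrict_space)

lemma emeasure_clock_space:
  assumes "0 < r" "A \<in> sets (gap_measure r)"
  shows "emeasure (clock_space r) (A \<inter> clock_seqs) = emeasure (gap_measure r) A"
proof -
  have "emeasure (clock_space r) (A \<inter> clock_seqs) = emeasure (gap_measure r) (A \<inter> clock_seqs)"
    using clock_seqs_measurable by (simp add: clock_space_eq emeasure_restrict_space)
  also have "\<dots> = emeasure (gap_measure r) A"
    using AE_clock_seqs[OF assms(1)] assms(2) clock_seqs_measurable
    by (intro emeasure_eq_AE) (auto elim: eventually_mono)
  finally show ?thesis .
qed

lemma prob_space_clock_space:
  assumes "0 < r"
  shows "prob_space (clock_space r)"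
proof
  interpret prob_space "gap_measure r" using assms by (rule prob_space_gap_measure)
  show "emeasure (clock_space r) (space (clock_space r)) = 1"
    using emeasure_clock_space[OF assms sets.top] emeasure_space_1 by simp
qed

lemma measurable_clock_space_gap [measurable]:
  "(\<lambda>\<xi>. \<xi> i) \<in> borel_measurable (clock_space r)"
proof -
  have "(\<lambda>\<xi>. \<xi> i) \<in> borel_measurable (gap_measure r)" by measurable
  then show ?thesis unfolding clock_space_eq by (rule measurable_restrict_space1)
qed

lemma measurable_clock_counts [measurable]:
  "Measurable.pred (clock_space r) (\<lambda>\<xi>. renewal_counts d cs (\<lambda>i. \<xi> (e i)))"
  unfolding renewal_counts_def by measurable

text \<open>An injective selection \<open>e\<close> of coordinates of an i.i.d. family is again
  i.i.d.; this carries the one-sided formula to both halves of a clock.\<close>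

lemma emeasure_clock_counts:
  assumes "0 < r" "inj e"
  shows "emeasure (clock_space r) {\<xi>\<in>clock_seqs. renewal_counts 1 cs (\<lambda>i. \<xi> (e i))} =
    ennreal (\<Prod>c\<leftarrow>cs. poisson_prob r c)"
proof -
  let ?f = "\<lambda>\<xi> i. \<xi> (e i)"
  have f [measurable]: "?f \<in> measurable (gap_measure r) (exp_gaps r)"
    unfolding exp_gaps_def gap_measure_def
    by (rule measurable_PiM_single', rule measurable_component_singleton) (auto simp: space_PiM)
  have "distr (gap_measure r) (exp_gaps r) ?f = exp_gaps r"
    using distr_PiM_reindex[of UNIV "\<lambda>_::int. density lborel (exponential_density r)" e UNIV] assms
    by (simp add: exp_gaps_def gap_measure_def prob_space_exponential_density restrict_UNIV)
  then have "emeasure (exp_gaps r) {\<omega>. renewal_counts 1 cs \<omega>} =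
      emeasure (distr (gap_measure r) (exp_gaps r) ?f) {\<omega>. renewal_counts 1 cs \<omega>}" by simp
  also have "\<dots> = emeasure (gap_measure r) {\<xi>. renewal_counts 1 cs (?f \<xi>)}"
    using measurable_renewal_counts by (subst emeasure_distr[OF f]) (simp_all add: pred_def vimage_def)
  also have "\<dots> = emeasure (clock_space r) ({\<xi>. renewal_counts 1 cs (?f \<xi>)} \<inter> clock_seqs)"
  proof (rule emeasure_clock_space[OF assms(1), symmetric])
    have "{\<xi>\<in>space (gap_measure r). renewal_counts 1 cs (?f \<xi>)} \<in> sets (gap_measure r)"
      using measurable_compose[OF f measurable_renewal_counts] by (simp add: pred_def)
    then show "{\<xi>. renewal_counts 1 cs (?f \<xi>)} \<in> sets (gap_measure r)" by simp
  qed
  also have "{\<xi>. renewal_counts 1 cs (?f \<xi>)} \<inter> clock_seqs = {\<xi>\<in>clock_seqs. renewal_counts 1 cs (?f \<xi>)}"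
    by auto
  finally show ?thesis using emeasure_renewal_counts[OF assms(1)] by simp
qed

section \<open>Uniqueness, existence and meaning of the count list of a fixed gap sequence\<close>

lemma renewal_counts_snoc:
  "renewal_counts d (cs @ [c]) \<omega> \<longleftrightarrow> renewal_counts d cs \<omega> \<and>
     (\<Sum>i<sum_list cs + c. \<omega> i) < d + real (length cs) \<and>
     d + real (length cs) \<le> (\<Sum>i<Suc (sum_list cs + c). \<omega> i)"
  by (auto simp: renewal_counts_def less_Suc_eq simp del: sum.lessThan_Suc)

lemma renewal_counts_append: "renewal_counts d (cs @ cs') \<omega> \<Longrightarrow> renewal_counts d cs \<omega>"
proof (induction cs' rule: rev_induct)
  case (snoc c cs')
  then show ?case using renewal_counts_snoc[of d "cs @ cs'" c \<omega>] by simp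
qed simp

lemma renewal_counts_take: "renewal_counts d cs \<omega> \<Longrightarrow> renewal_counts d (take m cs) \<omega>"
  by (metis append_take_drop_id renewal_counts_append)

lemma partial_sum_mono:
  fixes \<omega> :: "nat \<Rightarrow> real"
  assumes "\<forall>i. 0 \<le> \<omega> i" "l \<le> l'"
  shows "(\<Sum>i<l. \<omega> i) \<le> (\<Sum>i<l'. \<omega> i)"
  using assms by (intro sum_mono2) auto

lemma partial_sum_index:
  fixes \<omega> :: "nat \<Rightarrow> real"
  assumes "\<forall>i. 0 \<le> \<omega> i" "(\<Sum>i<l. \<omega> i) < b" "b \<le> (\<Sum>i<l'. \<omega> i)"
  shows "l < l'"
  using partial_sum_mono[OF assms(1), of l' l] assms(2,3) by (cases "l < l'") auto

text \<open>Partial sums are monotone, so the number of arrivals before each window end is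
  determined. Events of different count lists of the same length are therefore disjoint and their
  probabilities add.\<close>

lemma renewal_counts_unique:
  assumes "renewal_counts d cs \<omega>" "renewal_counts d cs' \<omega>" "length cs = length cs'"
  shows "cs = cs'"
  using assms
proof (induction cs arbitrary: cs' rule: rev_induct)
  case (snoc c cs)
  obtain cs0 c' where cs': "cs' = cs0 @ [c']" using snoc.prems(3) by (cases cs' rule: rev_cases) auto
  have pos: "\<forall>i. 0 \<le> \<omega> i" using snoc.prems(1) by (simp add: renewal_counts_def)
  have "cs = cs0" using snoc cs' by (simp add: renewal_counts_snoc)
  moreover have "sum_list cs + c < Suc (sum_list cs0 + c')" "sum_list cs0 + c' < Suc (sum_list cs + c)"
    using snoc.prems unfolding cs' renewal_counts_snoc
    by (auto intro!: partial_sum_index[OF pos] simp del: sum.lessThan_Suc)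
  ultimately show ?case by (simp add: cs')
qed simp

lemma renewal_counts_exist:
  assumes pos: "\<forall>i. 0 \<le> \<omega> i" and unbounded: "\<And>b. \<exists>l. b \<le> (\<Sum>i<l. \<omega> i)" and "0 < d"
  shows "\<exists>cs. length cs = M \<and> renewal_counts d cs \<omega>"
proof (induction M)
  case 0
  then show ?case using pos by (simp add: renewal_counts_def)
next
  case (Suc M)
  then obtain cs where cs: "length cs = M" "renewal_counts d cs \<omega>" by blast
  define b where "b = d + real M"
  \<comment> \<open>Counted from 1, arrival \<open>l\<close> is the first one at or after the new
    window end \<open>b\<close>. The \<open>C\<close> arrivals before it consist of those already
    counted in \<open>cs\<close> and those of the new window.\<close>
  define l where "l = (LEAST l. b \<le> (\<Sum>i<l. \<omega> i))"
  have l: "b \<le> (\<Sum>i<l. \<omega> i)" unfolding l_def by (rule LeastI_ex[OF unbounded])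
  have b: "0 < b" using \<open>0 < d\<close> by (simp add: b_def add_pos_nonneg)
  with l have "l \<noteq> 0" by (intro notI) simp
  then obtain C where C: "l = Suc C" by (cases l) auto
  then have less: "(\<Sum>i<C. \<omega> i) < b"
    using not_less_Least[of C "\<lambda>l. b \<le> (\<Sum>i<l. \<omega> i)"] by (simp add: l_def)
  have "sum_list cs \<le> C"
  proof (cases cs rule: rev_cases)
    case (snoc cs0 c)
    have "(\<Sum>i<sum_list cs. \<omega> i) < d + real (length cs0)"
      using cs(2) unfolding snoc renewal_counts_snoc by simp
    also have "d + real (length cs0) \<le> b" using cs(1) by (simp add: b_def snoc)
    also have "b \<le> (\<Sum>i<Suc C. \<omega> i)" using l C by simp
    finally have "(\<Sum>i<sum_list cs. \<omega> i) < (\<Sum>i<Suc C. \<omega> i)" .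
    then have "sum_list cs < Suc C" by (rule partial_sum_index[OF pos _ order_refl])
    then show ?thesis by simp
  qed simp
  then have "renewal_counts d (cs @ [C - sum_list cs]) \<omega>"
    using cs less l unfolding renewal_counts_snoc C b_def by simp
  then show ?case using cs(1) by (intro exI[of _ "cs @ [C - sum_list cs]"]) simp
qed

text \<open>Turns the cumulative bounds into the set of arrivals in one window: their indices form a
  run of consecutive naturals whose length is the count.\<close>

lemma renewal_counts_window:
  assumes "renewal_counts 1 cs \<omega>" "q < length cs"
  shows "{l. real q \<le> (\<Sum>i<Suc l. \<omega> i) \<and> (\<Sum>i<Suc l. \<omega> i) < real q + 1} =
    {sum_list (take q cs)..<sum_list (take q cs) + cs ! q}"
proof -
  let ?Y = "\<lambda>l. \<Sum>i<l. \<omega> i"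
  have pos: "\<forall>i. 0 \<le> \<omega> i" using assms by (simp add: renewal_counts_def)
  have less: "?Y (Suc l) < real (Suc m) \<longleftrightarrow> l < sum_list (take (Suc m) cs)" if "m < length cs" for l m
  proof -
    let ?C = "sum_list (take (Suc m) cs)"
    have C: "?Y ?C < real (Suc m)" "real (Suc m) \<le> ?Y (Suc ?C)"
      using assms(1) that unfolding renewal_counts_def by (auto simp: add.commute)
    show ?thesis
    proof
      assume "l < ?C"
      then have "?Y (Suc l) \<le> ?Y ?C" by (intro partial_sum_mono[OF pos]) simp
      with C show "?Y (Suc l) < real (Suc m)" by linarith
    next
      assume "?Y (Suc l) < real (Suc m)"
      from partial_sum_index[OF pos this C(2)] show "l < ?C" by simp
    qed
  qed
  have ge: "real q \<le> ?Y (Suc l) \<longleftrightarrow> sum_list (take q cs) \<le> l" for l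
  proof (cases q)
    case 0
    have "0 \<le> ?Y (Suc l)" using pos by (intro sum_nonneg) auto
    then show ?thesis by (simp only: 0) simp
  next
    case (Suc q')
    then show ?thesis using less[of q' l] assms(2) by (simp only: not_less[symmetric])
  qed
  have "real q + 1 = real (Suc q)" "sum_list (take q cs) + cs ! q = sum_list (take (Suc q) cs)"
    using assms(2) by (simp_all add: take_Suc_conv_app_nth)
  then show ?thesis unfolding ge by (auto simp only: less[OF assms(2)] atLeastLessThan_iff)
qed

section \<open>Recurrence of a pattern of counts\<close>

definition clock_counts :: "nat \<Rightarrow> (nat \<Rightarrow> int) \<Rightarrow> (nat \<Rightarrow> nat list) \<Rightarrow> (nat \<Rightarrow> int \<Rightarrow> real) \<Rightarrow> bool" where
  "clock_counts n e c \<omega> \<longleftrightarrow> (\<forall>k\<in>{0..n}. renewal_counts 1 (c k) (\<lambda>i. \<omega> k (e i)))"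

text \<open>Count list of clock \<open>k\<close> when each unit interval contains exactly one ring,
  the one in interval \<open>q\<close> coming from clock \<open>v ! q\<close>.\<close>

definition pattern_counts :: "nat list \<Rightarrow> nat \<Rightarrow> nat list" where
  "pattern_counts v k = map (\<lambda>l. if l = k then 1 else 0) v"

text \<open>Only blocks starting at multiples of \<open>length v\<close> are inspected; they are
  disjoint in time, hence independent. Extensionality makes distinct members differ at some clock in
  \<open>{0..n}\<close>, which keeps the corresponding events disjoint.\<close>

definition pattern_free :: "nat \<Rightarrow> nat list \<Rightarrow> nat \<Rightarrow> (nat \<Rightarrow> nat list) set" where
  "pattern_free n v R = {c \<in> extensional {0..n}. (\<forall>k\<in>{0..n}. length (c k) = R * length v) \<and>
     (\<forall>r<R. \<exists>k\<in>{0..n}. take (length v) (drop (r * length v) (c k)) \<noteq> pattern_counts v k)}"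

lemma countable_pattern_free: "countable (pattern_free n v R)"
proof (rule countable_subset)
  show "pattern_free n v R \<subseteq> {0..n} \<rightarrow>\<^sub>E UNIV" by (auto simp: pattern_free_def PiE_def)
  show "countable ({0..n} \<rightarrow>\<^sub>E (UNIV :: nat list set))" by (rule countable_PiE) auto
qed

text \<open>
  The gaps met on the way from time \<open>0\<close> into the future (\<open>e = int\<close>) or into the past
  (\<open>e = (\<lambda>i. - int (Suc i))\<close>).
\<close>

definition gap_order :: "(nat \<Rightarrow> int) \<Rightarrow> bool" where
  "gap_order e \<longleftrightarrow> inj e \<and>
     (\<forall>\<xi>\<in>clock_seqs. (\<forall>i. 0 \<le> \<xi> (e i)) \<and> (\<forall>b. \<exists>l. b \<le> (\<Sum>i<l. \<xi> (e i))))"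

section \<open>Geometric decay of the probability that a pattern is missing\<close>

locale poisson_clocks =
  fixes n :: nat and rate :: "nat \<Rightarrow> real" and e :: "nat \<Rightarrow> int" and v :: "nat list"
  assumes rate_pos: "k \<le> n \<Longrightarrow> 0 < rate k"
    and gap_order: "gap_order e"
    and v_nonempty: "v \<noteq> []"
begin

definition clocks :: "(nat \<Rightarrow> int \<Rightarrow> real) measure" where
  "clocks = (\<Pi>\<^sub>M k\<in>{0..n}. clock_space (rate k))"

definition pattern_prob :: real where
  "pattern_prob = (\<Prod>k\<in>{0..n}. \<Prod>c\<leftarrow>pattern_counts v k. poisson_prob (rate k) c)"

definition pattern_free_event :: "nat \<Rightarrow> (nat \<Rightarrow> int \<Rightarrow> real) set" where
  "pattern_free_event R = (\<Union>c\<in>pattern_free n v R. {\<omega>\<in>space clocks. clock_counts n e c \<omega>})"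

sublocale prob_space clocks
  unfolding clocks_def using rate_pos by (intro prob_space_PiM prob_space_clock_space) auto

lemma space_clocks: "space clocks = {0..n} \<rightarrow>\<^sub>E clock_seqs"
  by (simp add: clocks_def space_PiM)

lemma clock_counts_PiE:
  "{\<omega>\<in>space clocks. clock_counts n e c \<omega>} =
    (\<Pi>\<^sub>E k\<in>{0..n}. {\<xi>\<in>clock_seqs. renewal_counts 1 (c k) (\<lambda>i. \<xi> (e i))})"
  by (rule set_eqI) (simp add: space_clocks clock_counts_def PiE_iff, blast)

lemma sets_clock_counts_single:
  "{\<xi>\<in>clock_seqs. renewal_counts 1 cs (\<lambda>i. \<xi> (e i))} \<in> sets (clock_space r)"
  using measurable_clock_counts[where r = r and d = 1 and cs = cs and e = e] by (simp add: pred_def)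

lemma sets_clock_counts [measurable]: "{\<omega>\<in>space clocks. clock_counts n e c \<omega>} \<in> sets clocks"
  unfolding clock_counts_PiE unfolding clocks_def
  by (intro sets_PiM_I_finite sets_clock_counts_single) auto

lemma sets_pattern_free_event [measurable]: "pattern_free_event R \<in> sets clocks"
  unfolding pattern_free_event_def by (intro sets.countable_UN' countable_pattern_free image_subsetI sets_clock_counts)

lemma prob_clock_counts:
  "prob {\<omega>\<in>space clocks. clock_counts n e c \<omega>} =
    (\<Prod>k\<in>{0..n}. \<Prod>c'\<leftarrow>c k. poisson_prob (rate k) c')"
proof -
  let ?A = "\<lambda>k. {\<xi>\<in>clock_seqs. renewal_counts 1 (c k) (\<lambda>i. \<xi> (e i))}"
  have nonneg: "0 \<le> (\<Prod>c'\<leftarrow>c k. poisson_prob (rate k) c')" if "k \<le> n" for k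
    using rate_pos[OF that] by (intro prod_list_nonneg) (auto simp: poisson_prob_nonneg)
  have "emeasure clocks {\<omega>\<in>space clocks. clock_counts n e c \<omega>} =
      emeasure clocks (prod_emb {0..n} (\<lambda>k. clock_space (rate k)) {0..n} (Pi\<^sub>E {0..n} ?A))"
    unfolding clock_counts_PiE by (subst prod_emb_PiE_same_index) auto
  also have "\<dots> = (\<Prod>k\<in>{0..n}. emeasure (clock_space (rate k)) (?A k))"
    unfolding clocks_def using rate_pos
    by (intro emeasure_PiM_emb prob_space_clock_space sets_clock_counts_single) auto
  also have "\<dots> = (\<Prod>k\<in>{0..n}. ennreal (\<Prod>c'\<leftarrow>c k. poisson_prob (rate k) c'))"
    using rate_pos gap_order by (intro prod.cong emeasure_clock_counts) (auto simp: gap_order_def)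
  also have "\<dots> = ennreal (\<Prod>k\<in>{0..n}. \<Prod>c'\<leftarrow>c k. poisson_prob (rate k) c')"
    using nonneg by (intro prod_ennreal) auto
  finally have "emeasure clocks {\<omega>\<in>space clocks. clock_counts n e c \<omega>} =
      ennreal (\<Prod>k\<in>{0..n}. \<Prod>c'\<leftarrow>c k. poisson_prob (rate k) c')" .
  moreover have "0 \<le> (\<Prod>k\<in>{0..n}. \<Prod>c'\<leftarrow>c k. poisson_prob (rate k) c')"
    using nonneg by (intro prod_nonneg) auto
  ultimately show ?thesis by (simp add: emeasure_eq_measure)
qed

lemma pattern_prob_bounds: "0 < pattern_prob" "pattern_prob \<le> 1"
proof -
  have "0 < (\<Prod>c\<leftarrow>cs. poisson_prob (rate k) c)" if "k \<le> n" for k cs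
    using rate_pos[OF that] by (induction cs) (auto simp: poisson_prob_pos)
  then show "0 < pattern_prob" unfolding pattern_prob_def by (intro prod_pos) auto
  show "pattern_prob \<le> 1"
    unfolding pattern_prob_def prob_clock_counts[symmetric] by (rule prob_le_1)
qed

lemma clock_counts_disjoint:
  "disjoint_family_on (\<lambda>c. {\<omega>\<in>space clocks. clock_counts n e c \<omega>}) (pattern_free n v R)"
  unfolding disjoint_family_on_def
proof (intro ballI impI)
  fix c c' assume c: "c \<in> pattern_free n v R" "c' \<in> pattern_free n v R" "c \<noteq> c'"
  have "c = c'" if "clock_counts n e c \<omega>" "clock_counts n e c' \<omega>" for \<omega>
  proof (rule extensionalityI[of _ "{0..n}"])
    fix k assume "k \<in> {0..n}"
    with that c show "c k = c' k" unfolding clock_counts_def pattern_free_def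
      by (intro renewal_counts_unique[of 1 "c k" "\<lambda>i. \<omega> k (e i)" "c' k"]) auto
  qed (use c in \<open>auto simp: pattern_free_def\<close>)
  with c(3) show "{\<omega>\<in>space clocks. clock_counts n e c \<omega>} \<inter> {\<omega>\<in>space clocks. clock_counts n e c' \<omega>} = {}"
    by blast
qed

text \<open>Each pattern-free history \<open>c\<close> is continued by a block carrying the pattern
  with conditional probability exactly \<open>pattern_prob\<close>, whatever \<open>c\<close> is,
  since \<open>prob_clock_counts\<close> factorises over windows. Summed over the disjoint
  histories, this fraction is removed in every step.\<close>

lemma prob_pattern_free_event: "prob (pattern_free_event R) \<le> (1 - pattern_prob) ^ R"
proof (induction R)
  case (Suc R)
  let ?ext = "\<lambda>c k. c k @ pattern_counts v k"
  let ?E = "\<lambda>c. {\<omega>\<in>space clocks. clock_counts n e c \<omega>}"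
  \<comment> \<open>No pattern in the first \<open>R\<close> blocks, but the pattern in the next
    one: a part of \<open>pattern_free_event R\<close> that is lost when passing to
    \<open>Suc R\<close>.\<close>
  define H where "H = (\<Union>c\<in>pattern_free n v R. ?E (?ext c))"
  have sub: "?E (?ext c) \<subseteq> ?E c" for c
    by (auto simp: clock_counts_def dest: renewal_counts_append)
  have H [measurable]: "H \<in> sets clocks"
    unfolding H_def by (intro sets.countable_UN' countable_pattern_free image_subsetI sets_clock_counts)
  have "H \<subseteq> pattern_free_event R"
    unfolding H_def pattern_free_event_def using sub by blast
  have ext: "prob (?E (?ext c)) = pattern_prob * prob (?E c)" for c
    by (simp add: prob_clock_counts pattern_prob_def prod.distrib)
  have "emeasure clocks H = (\<integral>\<^sup>+c. emeasure clocks (?E (?ext c)) \<partial>count_space (pattern_free n v R))"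
    unfolding H_def
    using clock_counts_disjoint sub
    by (intro emeasure_UN_countable sets_clock_counts countable_pattern_free)
      (fastforce simp: disjoint_family_on_def)+
  also have "\<dots> = (\<integral>\<^sup>+c. ennreal pattern_prob * emeasure clocks (?E c) \<partial>count_space (pattern_free n v R))"
    using pattern_prob_bounds by (simp add: emeasure_eq_measure ext ennreal_mult)
  also have "\<dots> = ennreal pattern_prob * emeasure clocks (pattern_free_event R)"
    unfolding pattern_free_event_def
    by (subst emeasure_UN_countable)
      (simp_all add: nn_integral_cmult sets_clock_counts countable_pattern_free clock_counts_disjoint)
  finally have prob_H: "prob H = pattern_prob * prob (pattern_free_event R)"
    using pattern_prob_bounds by (simp add: emeasure_eq_measure ennreal_mult[symmetric])
  have "pattern_free_event (Suc R) \<subseteq> pattern_free_event R - H"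
  proof
    fix \<omega> assume "\<omega> \<in> pattern_free_event (Suc R)"
    then obtain c where c: "c \<in> pattern_free n v (Suc R)" "\<omega> \<in> space clocks" "clock_counts n e c \<omega>"
      by (auto simp: pattern_free_event_def)
    define c0 where "c0 = (\<lambda>k\<in>{0..n}. take (R * length v) (c k))"
    have "c0 \<in> pattern_free n v R"
    proof -
      have "take (length v) (drop (r * length v) (take (R * length v) (c k))) =
          take (length v) (drop (r * length v) (c k))" if "r < R" for r k
      proof -
        have "Suc r * length v \<le> R * length v" using that by (intro mult_le_mono1) simp
        then have "length v \<le> R * length v - r * length v" by simp
        then show ?thesis by (simp add: drop_take min_def)
      qed
      then show ?thesis using c(1) by (auto simp: pattern_free_def c0_def)
    qed
    moreover have "clock_counts n e c0 \<omega>"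
      using c(3) by (auto simp: clock_counts_def c0_def intro: renewal_counts_take)
    \<comment> \<open>By uniqueness of counts, a path in \<open>H\<close> would show the pattern in
      block number \<open>R\<close>, which \<open>c\<close> excludes.\<close>
    moreover have "\<omega> \<notin> H"
    proof
      assume "\<omega> \<in> H"
      then obtain c' where c': "c' \<in> pattern_free n v R" "clock_counts n e (?ext c') \<omega>"
        by (auto simp: H_def)
      have "take (length v) (drop (R * length v) (c k)) = pattern_counts v k" if "k \<in> {0..n}" for k
      proof -
        have len: "length (c' k) = R * length v" using c'(1) that by (simp add: pattern_free_def)
        have "c k = c' k @ pattern_counts v k"
          using c c' that len by (intro renewal_counts_unique[of 1 _ "\<lambda>i. \<omega> k (e i)"])
            (auto simp: clock_counts_def pattern_free_def pattern_counts_def)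
        then show ?thesis using len by (simp add: pattern_counts_def)
      qed
      moreover obtain k where "k \<in> {0..n}"
          "take (length v) (drop (R * length v) (c k)) \<noteq> pattern_counts v k"
        using c(1) unfolding pattern_free_def by blast
      ultimately show False by blast
    qed
    ultimately show "\<omega> \<in> pattern_free_event R - H" using c(2) by (auto simp: pattern_free_event_def)
  qed
  then have "prob (pattern_free_event (Suc R)) \<le> prob (pattern_free_event R - H)"
    by (intro finite_measure_mono) auto
  also have "\<dots> = (1 - pattern_prob) * prob (pattern_free_event R)"
    using \<open>H \<subseteq> _\<close> by (simp add: finite_measure_Diff prob_H algebra_simps)
  also have "\<dots> \<le> (1 - pattern_prob) ^ Suc R"
    using Suc pattern_prob_bounds by (simp add: mult_left_mono)
  finally show ?case .
qed simp

text \<open>The bound \<open>(1 - pattern_prob) ^ R\<close> tends to 0, so almost every path lies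
  outside some \<open>pattern_free_event R\<close>. As its counts exist, one of its blocks must
  carry \<open>v\<close>. The conclusion speaks of index sets of arrivals, of which only the size, 0
  or 1, matters later.\<close>

lemma AE_pattern:
  "AE \<omega> in clocks. \<exists>r. \<forall>k\<in>{0..n}. \<forall>q<length v. \<exists>a.
     {l. real (r * length v + q) \<le> (\<Sum>i<Suc l. \<omega> k (e i)) \<and>
         (\<Sum>i<Suc l. \<omega> k (e i)) < real (r * length v + q) + 1} =
     {a..<a + (if v ! q = k then 1 else 0)}"
proof -
  have "(\<lambda>R. (1 - pattern_prob) ^ R) \<longlonglongrightarrow> 0"
    using pattern_prob_bounds by (intro LIMSEQ_power_zero) auto
  moreover have "prob (\<Inter>R. pattern_free_event R) \<le> (1 - pattern_prob) ^ R" for R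
    by (rule order_trans[OF finite_measure_mono prob_pattern_free_event]) auto
  ultimately have "prob (\<Inter>R. pattern_free_event R) \<le> 0"
    by (intro LIMSEQ_le_const) auto
  then have "(\<Inter>R. pattern_free_event R) \<in> null_sets clocks"
    by (simp add: null_sets_def emeasure_eq_measure measure_le_0_iff)
  then have "AE \<omega> in clocks. \<omega> \<notin> (\<Inter>R. pattern_free_event R)" by (rule AE_not_in)
  with AE_space show ?thesis
  proof eventually_elim
    case (elim \<omega>)
    then obtain R where R: "\<omega> \<notin> pattern_free_event R" by blast
    have "\<exists>cs. length cs = R * length v \<and> renewal_counts 1 cs (\<lambda>i. \<omega> k (e i))" if "k \<in> {0..n}" for k
    proof (rule renewal_counts_exist)
      have "\<omega> k \<in> clock_seqs" using elim(1) that by (auto simp: space_clocks)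
      then show "\<forall>i. 0 \<le> \<omega> k (e i)" "\<exists>l. b \<le> (\<Sum>i<l. \<omega> k (e i))" for b
        using gap_order unfolding gap_order_def by blast+
    qed simp
    then obtain c0 where c0: "\<And>k. k \<in> {0..n} \<Longrightarrow> length (c0 k) = R * length v"
      "\<And>k. k \<in> {0..n} \<Longrightarrow> renewal_counts 1 (c0 k) (\<lambda>i. \<omega> k (e i))"
      by metis
    have "restrict c0 {0..n} \<notin> pattern_free n v R"
      using R elim(1) c0(2) by (auto simp: pattern_free_event_def clock_counts_def)
    then obtain r where r: "r < R"
      "\<And>k. k \<in> {0..n} \<Longrightarrow> take (length v) (drop (r * length v) (c0 k)) = pattern_counts v k"
      using c0(1) by (auto simp: pattern_free_def)
    show ?case
    proof (rule exI[of _ r], intro ballI allI impI)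
      fix k q assume k: "k \<in> {0..n}" and q: "q < length v"
      have "Suc r * length v \<le> R * length v" using r(1) by (intro mult_le_mono1) simp
      then have len: "r * length v + q < length (c0 k)" using q c0(1)[OF k] by simp
      have "c0 k ! (r * length v + q) = take (length v) (drop (r * length v) (c0 k)) ! q"
        using q len by simp
      also have "\<dots> = (if v ! q = k then 1 else 0)" using q by (simp add: r(2)[OF k] pattern_counts_def)
      finally have nth: "c0 k ! (r * length v + q) = (if v ! q = k then 1 else 0)" .
      show "\<exists>a. {l. real (r * length v + q) \<le> (\<Sum>i<Suc l. \<omega> k (e i)) \<and>
          (\<Sum>i<Suc l. \<omega> k (e i)) < real (r * length v + q) + 1} = {a..<a + (if v ! q = k then 1 else 0)}"
        by (rule exI, rule renewal_counts_window[OF c0(2)[OF k] len, unfolded nth])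
    qed
  qed
qed

end

section \<open>A synchronising word\<close>

definition sweep :: "nat \<Rightarrow> nat list" where
  "sweep n = rev [1..<Suc n]"

definition sync_word :: "nat \<Rightarrow> nat list" where
  "sync_word n = concat (replicate n (sweep n))"

text \<open>Ringing from right to left means that site \<open>m + 1\<close> has just been vacated
  when clock \<open>m < n\<close> rings, so no jump is blocked. The particles to the left of
  \<open>m\<close> have not moved yet.\<close>

lemma hops_rev_upt:
  assumes "1 \<le> m" "m \<le> n" "x \<in> tasep_states n" "i \<in> {1..n}"
  shows "hops n (rev [m..<Suc n]) x i = (if i < m then x i else if i = m then 0 else x (i - 1))"
  using assms(2,1,4)
proof (induction arbitrary: i rule: inc_induct)
  case base
  then show ?case using assms(3) by (auto simp: hop_def)
next
  case (step m)
  let ?y = "hops n (rev [Suc m..<Suc n]) x"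
  have y: "?y i = (if i < Suc m then x i else if i = Suc m then 0 else x (i - 1))" if "i \<in> {1..n}" for i
    using step.IH[of i] that by simp
  have "[m..<Suc n] = m # [Suc m..<Suc n]" using step.hyps by (intro upt_conv_Cons) simp
  then have "hops n (rev [m..<Suc n]) x = hop n ?y m" by simp
  \<comment> \<open>If occupied, site \<open>m\<close> passes its particle on; if empty, nothing
    moves. Both cases leave 0 at \<open>m\<close> and the old \<open>x m\<close> at
    \<open>m + 1\<close>.\<close>
  moreover have "x m = 0 \<or> x m = 1"
  proof -
    have "m \<in> {1..n}" using step by auto
    then have "x m \<in> {0, 1}" using assms(3) unfolding tasep_states_def by (rule PiE_mem[rotated])
    then show ?thesis by auto
  qed
  ultimately show ?case
    using step y[of i] y[of m] y[of "m + 1"] by (auto simp: hop_def)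
qed

lemma hops_sweep:
  assumes "1 \<le> n" "x \<in> tasep_states n" "i \<in> {1..n}"
  shows "hops n (sweep n) x i = (if i = 1 then 0 else x (i - 1))"
  using hops_rev_upt[of 1 n x i] assms by (simp add: sweep_def del: upt_Suc)

lemma set_sweep: "set (sweep n) \<subseteq> {0..n}"
  by (auto simp: sweep_def)

text \<open>Clock 0 is silent in a sweep, so each sweep shifts in one empty site from the
  left.\<close>

lemma hops_sweeps:
  assumes "1 \<le> n" "x \<in> tasep_states n" "i \<in> {1..n}" "i \<le> j"
  shows "hops n (concat (replicate j (sweep n))) x i = 0"
  using assms
proof (induction j arbitrary: i)
  case (Suc j)
  let ?y = "hops n (concat (replicate j (sweep n))) x"
  have "set (concat (replicate j (sweep n))) \<subseteq> {0..n}" using set_sweep[of n] by auto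
  then have "?y \<in> tasep_states n" using Suc.prems by (intro hops_in_states)
  moreover have "concat (replicate (Suc j) (sweep n)) = concat (replicate j (sweep n)) @ sweep n"
    by (simp add: replicate_append_same[symmetric])
  ultimately have step: "hops n (concat (replicate (Suc j) (sweep n))) x i = (if i = 1 then 0 else ?y (i - 1))"
    using Suc.prems by (simp add: hops_sweep)
  have "?y (i - 1) = 0" if "i \<noteq> 1" using Suc.prems that by (intro Suc.IH) auto
  then show ?case unfolding step by simp
qed simp

lemma set_sync_word: "set (sync_word n) \<subseteq> {0..n}"
  using set_sweep[of n] by (auto simp: sync_word_def)

lemma hops_sync_word:
  assumes "1 \<le> n" "x \<in> tasep_states n"
  shows "hops n (sync_word n) x = (\<lambda>i\<in>{1..n}. 0)"
proof
  fix i
  have "hops n (sync_word n) x \<in> tasep_states n" using assms set_sync_word by (intro hops_in_states)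
  then have "i \<notin> {1..n} \<Longrightarrow> hops n (sync_word n) x i = undefined"
    unfolding tasep_states_def by (rule PiE_arb)
  then show "hops n (sync_word n) x i = (\<lambda>i\<in>{1..n}. 0) i"
    using hops_sweeps[OF assms, of i n] by (auto simp: sync_word_def)
qed

lemma sync_word_nonempty: "1 \<le> n \<Longrightarrow> sync_word n \<noteq> []"
  by (cases n) (simp_all add: sync_word_def sweep_def)

text \<open>Rings before the word only move states within the state space, the word sends all of
  them to the empty configuration, and later rings act on that one state. The pieces
  \<open>P\<close>, \<open>F\<close>, \<open>Q\<close> are arbitrary ordered sets because the
  backward unit intervals are open on the left and do not have the form of a
  \<open>ring_word\<close> window.\<close>

lemma window_image_singleton:
  assumes "1 \<le> n" "\<omega> \<in> tasep_paths n"
    and F: "ring_times n \<omega> \<inter> {a..<b} = P \<union> F \<union> Q"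
      "\<And>s t. s \<in> P \<Longrightarrow> t \<in> F \<Longrightarrow> s < t" "\<And>s t. s \<in> P \<Longrightarrow> t \<in> Q \<Longrightarrow> s < t" "\<And>s t. s \<in> F \<Longrightarrow> t \<in> Q \<Longrightarrow> s < t"
    and sync: "sites_of n \<omega> F = sync_word n"
  shows "is_singleton (window_image n \<omega> a b)"
proof -
  have "finite (P \<union> F \<union> Q)" using assms(2) unfolding F(1)[symmetric] by simp
  then have fin: "finite P" "finite F" "finite Q" by auto
  have "ring_word n \<omega> a b = sites_of n \<omega> (P \<union> F) @ sites_of n \<omega> Q"
    unfolding ring_word_def F(1) by (rule sites_of_Un) (use fin F in auto)
  also have "sites_of n \<omega> (P \<union> F) = sites_of n \<omega> P @ sync_word n"
    unfolding sync[symmetric] by (rule sites_of_Un) (use fin F in auto)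
  finally have word: "ring_word n \<omega> a b = sites_of n \<omega> P @ sync_word n @ sites_of n \<omega> Q" by simp
  have "set (sites_of n \<omega> P) \<subseteq> {0..n}"
    using set_ring_word[OF assms(2), of a b] unfolding word by simp
  then have "hops n (sites_of n \<omega> P) x \<in> tasep_states n" if "x \<in> tasep_states n" for x
    using hops_in_states assms(1) that by blast
  then have "hops n (ring_word n \<omega> a b) x = hops n (sites_of n \<omega> Q) (\<lambda>i\<in>{1..n}. 0)"
    if "x \<in> tasep_states n" for x
    using that assms(1) by (simp add: word hops_sync_word)
  then have "window_image n \<omega> a b = (\<lambda>_. hops n (sites_of n \<omega> Q) (\<lambda>i\<in>{1..n}. 0)) ` tasep_states n"
    unfolding window_image_def by (intro image_cong refl)
  then show ?thesis by (simp add: image_constant_conv)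
qed

text \<open>The order of the sets \<open>U q\<close> sorts the rings, one per set, wherever each
  ring falls within its set. Thus the counts of the separate clocks determine the interleaved
  word.\<close>

lemma sites_of_pattern:
  fixes U :: "nat \<Rightarrow> real set"
  assumes "\<omega> \<in> tasep_paths n" "set w \<subseteq> {0..n}"
    and order: "\<And>q q' s s'. q < q' \<Longrightarrow> q' < length w \<Longrightarrow> s \<in> U q \<Longrightarrow> s' \<in> U q' \<Longrightarrow> s < s'"
    and ring: "\<And>q. q < length w \<Longrightarrow> \<exists>s. range (arrival_times (\<omega> (w ! q))) \<inter> U q = {s}"
    and silent: "\<And>k q. k \<le> n \<Longrightarrow> q < length w \<Longrightarrow> w ! q \<noteq> k \<Longrightarrow> range (arrival_times (\<omega> k)) \<inter> U q = {}"
  shows "sites_of n \<omega> (ring_times n \<omega> \<inter> (\<Union>q<length w. U q)) = w"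
proof -
  obtain u where u: "\<And>q. q < length w \<Longrightarrow> range (arrival_times (\<omega> (w ! q))) \<inter> U q = {u q}"
    using ring by metis
  have le: "w ! q \<le> n" if "q < length w" for q
    using nth_mem[OF that] assms(2) by auto
  have eq: "ring_times n \<omega> \<inter> U q = {u q}" if q: "q < length w" for q
  proof
    show "{u q} \<subseteq> ring_times n \<omega> \<inter> U q"
    proof -
      have "u q \<in> range (arrival_times (\<omega> (w ! q)))" "u q \<in> U q" using u[OF q] by blast+
      then show ?thesis using le[OF q] by (auto simp: ring_times_def)
    qed
    show "ring_times n \<omega> \<inter> U q \<subseteq> {u q}"
    proof
      fix s assume "s \<in> ring_times n \<omega> \<inter> U q"
      then obtain k j where k: "k \<le> n" "s = arrival_times (\<omega> k) j" "s \<in> U q"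
        by (auto simp: ring_times_def)
      then have "w ! q = k" using silent[OF k(1) q] by blast
      with k u[OF q] show "s \<in> {u q}" by blast
    qed
  qed
  have mem: "u q \<in> U q" if "q < length w" for q using u[OF that] by blast
  have "u q < u q'" if "q < q'" "q' < length w" for q q'
    using that by (intro order[OF that] mem) auto
  then have "sorted_wrt (<) (map u [0..<length w])" by (simp add: sorted_wrt_iff_nth_less)
  moreover have "set (map u [0..<length w]) = ring_times n \<omega> \<inter> (\<Union>q<length w. U q)"
    using eq by (auto simp: atLeast0LessThan)
  ultimately have "sorted_list_of_set (ring_times n \<omega> \<inter> (\<Union>q<length w. U q)) = map u [0..<length w]"
    by (metis sorted_list_of_set.idem_if_sorted_distinct strict_sorted_iff)
  moreover have "ring_site n \<omega> (u q) = w ! q" if q: "q < length w" for q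
  proof -
    obtain j where "u q = arrival_times (\<omega> (w ! q)) j" using u[OF q] by blast
    then show ?thesis using ring_site_arrival[OF assms(1) le[OF q]] by simp
  qed
  ultimately show ?thesis by (auto simp: sites_of_def intro: nth_equalityI)
qed

section \<open>Rings in unit intervals after and before time 0\<close>

lemma gap_order_int: "gap_order int"
  unfolding gap_order_def
proof (intro conjI ballI allI)
  fix \<xi> assume \<xi>: "\<xi> \<in> clock_seqs"
  show "0 \<le> \<xi> (int i)" for i using \<xi> by (cases "i = 0") (auto simp: clock_seqs_def less_imp_le)
  fix b
  obtain j where "b < arrival_times \<xi> j"
    using clock_arrivals_arrival_times[OF \<xi>] unfolding clock_arrivals_def by blast
  also have "arrival_times \<xi> j \<le> arrival_times \<xi> (int (nat j))"
    using strict_mono_arrival_times[OF \<xi>] by (simp add: strict_mono_less_eq)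
  also have "\<dots> = (\<Sum>i<Suc (nat j). \<xi> (int i))" by (rule arrival_times_of_nat)
  finally show "\<exists>l. b \<le> (\<Sum>i<l. \<xi> (int i))" by (blast intro: less_imp_le)
qed simp

lemma gap_order_minus_Suc: "gap_order (\<lambda>i. - int (Suc i))"
  unfolding gap_order_def
proof (intro conjI ballI allI)
  fix \<xi> assume \<xi>: "\<xi> \<in> clock_seqs"
  show "0 \<le> \<xi> (- int (Suc i))" for i
    using \<xi> by (auto simp: clock_seqs_def intro!: less_imp_le)
  fix b
  obtain j where j: "arrival_times \<xi> j < - b"
    using clock_arrivals_arrival_times[OF \<xi>] unfolding clock_arrivals_def by blast
  have "arrival_times \<xi> (- int (Suc (nat (- j)))) \<le> arrival_times \<xi> j"
    using strict_mono_arrival_times[OF \<xi>] by (simp add: strict_mono_less_eq)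
  with j have "b \<le> (\<Sum>i<Suc (nat (- j)). \<xi> (- int (Suc i)))"
    unfolding arrival_times_minus_Suc by linarith
  then show "\<exists>l. b \<le> (\<Sum>i<l. \<xi> (- int (Suc i)))" by blast
qed (simp add: inj_def)

lemma arrivals_forward_window:
  assumes "\<xi> \<in> clock_seqs"
  shows "range (arrival_times \<xi>) \<inter> {real m..<real m + 1} = (\<lambda>l. arrival_times \<xi> (int l)) `
    {l. real m \<le> (\<Sum>i<Suc l. \<xi> (int i)) \<and> (\<Sum>i<Suc l. \<xi> (int i)) < real m + 1}"
proof -
  have "\<exists>l. j = int l" if "real m \<le> arrival_times \<xi> j" for j
  proof -
    have "arrival_times \<xi> (- 1) < 0"
      using clock_arrivals_arrival_times[OF assms] by (simp add: clock_arrivals_def)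
    with that have "arrival_times \<xi> (- 1) < arrival_times \<xi> j" by (meson less_le_trans of_nat_0_le_iff)
    then have "0 \<le> j" using strict_mono_arrival_times[OF assms] by (simp add: strict_mono_less)
    then show ?thesis by (rule nonneg_int_cases) blast
  qed
  then show ?thesis unfolding arrival_times_of_nat[symmetric] by force
qed

text \<open>An arrival at time \<open>0\<close> ends the gap \<open>\<xi> 0\<close> of the future half, hence \<open>{..<0}\<close>.\<close>

lemma arrivals_backward_window:
  assumes "\<xi> \<in> clock_seqs"
  shows "range (arrival_times \<xi>) \<inter> ({- (real m + 1)<..- real m} \<inter> {..<0}) =
    (\<lambda>l. arrival_times \<xi> (- int (Suc l))) ` {l. real m \<le> (\<Sum>i<Suc l. \<xi> (- int (Suc i))) \<and>
      (\<Sum>i<Suc l. \<xi> (- int (Suc i))) < real m + 1}"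
proof -
  have sign: "arrival_times \<xi> (- 1) < 0" "0 \<le> arrival_times \<xi> 0"
    using clock_arrivals_arrival_times[OF assms] by (auto simp: clock_arrivals_def)
  have "\<exists>l. j = - int (Suc l)" if "arrival_times \<xi> j < 0" for j
  proof -
    have "arrival_times \<xi> j < arrival_times \<xi> 0" using that sign(2) by simp
    then have "j < 0" using strict_mono_arrival_times[OF assms] by (simp add: strict_mono_less)
    then show ?thesis by (intro exI[of _ "nat (- j) - 1"]) simp
  qed
  moreover have "arrival_times \<xi> (- int (Suc l)) < 0" for l
  proof -
    have "arrival_times \<xi> (- int (Suc l)) \<le> arrival_times \<xi> (- 1)"
      using strict_mono_arrival_times[OF assms] by (simp add: strict_mono_less_eq)
    with sign show ?thesis by simp
  qed
  moreover have "(\<Sum>i<Suc l. \<xi> (- int (Suc i))) = - arrival_times \<xi> (- int (Suc l))" for l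
    by (simp only: arrival_times_minus_Suc minus_minus)
  ultimately show ?thesis by (force simp del: sum.lessThan_Suc of_nat_Suc)
qed

lemma UN_forward_units: "(\<Union>q<L. {real (m + q)..<real (m + q) + 1}) = {real m..<real (m + L)}"
proof (induction L)
  case (Suc L)
  show ?case unfolding lessThan_Suc UN_insert Suc.IH by auto
qed simp

text \<open>Here \<open>q\<close> runs from the earliest interval to the latest, as the order
  hypothesis of \<open>sites_of_pattern\<close> demands.\<close>

lemma UN_backward_units:
  "(\<Union>q<L. {- (real (m + (L - Suc q)) + 1)<..- real (m + (L - Suc q))}) = {- real (m + L)<..- real m}"
proof -
  have "(\<lambda>q. L - Suc q) ` {..<L} = {..<L}"
  proof
    show "{..<L} \<subseteq> (\<lambda>q. L - Suc q) ` {..<L}"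
    proof
      fix q assume "q \<in> {..<L}"
      then show "q \<in> (\<lambda>q. L - Suc q) ` {..<L}" by (intro image_eqI[of _ _ "L - Suc q"]) auto
    qed
  qed auto
  then have "(\<Union>q<L. f (L - Suc q)) = (\<Union>q<L. f q)" for f :: "nat \<Rightarrow> real set"
    using image_image[of f "\<lambda>q. L - Suc q" "{..<L}"] by simp
  from this[of "\<lambda>q. {- (real (m + q) + 1)<..- real (m + q)}"]
  have "(\<Union>q<L. {- (real (m + (L - Suc q)) + 1)<..- real (m + (L - Suc q))}) =
      (\<Union>q<L. {- (real (m + q) + 1)<..- real (m + q)})" .
  also have "\<dots> = {- real (m + L)<..- real m}"
  proof (induction L)
    case (Suc L)
    show ?case unfolding lessThan_Suc UN_insert Suc.IH by auto
  qed simp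
  finally show ?thesis .
qed

lemma forward_synchronisation:
  fixes n r :: nat
  defines "w \<equiv> sync_word n"
  assumes "1 \<le> n" "\<omega> \<in> tasep_paths n"
    and pattern: "\<forall>k\<in>{0..n}. \<forall>q<length w. \<exists>a.
     {l. real (r * length w + q) \<le> (\<Sum>i<Suc l. \<omega> k (int i)) \<and>
         (\<Sum>i<Suc l. \<omega> k (int i)) < real (r * length w + q) + 1} =
     {a..<a + (if w ! q = k then 1 else 0)}"
  shows "is_singleton (window_image n \<omega> 0 (real (r * length w + length w)))"
proof -
  let ?m = "r * length w"
  let ?U = "\<lambda>q. {real (?m + q)..<real (?m + q) + 1}"
  have card: "\<exists>a. range (arrival_times (\<omega> k)) \<inter> ?U q =
      (\<lambda>l. arrival_times (\<omega> k) (int l)) ` {a..<a + (if w ! q = k then 1 else 0)}"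
    if "k \<le> n" "q < length w" for k q
  proof -
    have "k \<in> {0..n}" using that(1) by simp
    from pattern[THEN bspec, OF this, THEN spec, THEN mp, OF that(2)]
    obtain a where a: "{l. real (?m + q) \<le> (\<Sum>i<Suc l. \<omega> k (int i)) \<and>
        (\<Sum>i<Suc l. \<omega> k (int i)) < real (?m + q) + 1} = {a..<a + (if w ! q = k then 1 else 0)}"
      by (rule exE)
    show ?thesis
      unfolding arrivals_forward_window[OF clock_seqs_of_path[OF assms(3) that(1)]] a
      by (rule exI, rule refl)
  qed
  have w: "w ! q \<le> n" if "q < length w" for q
    using nth_mem[OF that] set_sync_word[of n] unfolding w_def by auto
  have "sites_of n \<omega> (ring_times n \<omega> \<inter> (\<Union>q<length w. ?U q)) = w"
  proof (rule sites_of_pattern[OF assms(3)])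
    show "set w \<subseteq> {0..n}" unfolding w_def by (rule set_sync_word)
    show "s < s'" if "q < q'" "s \<in> ?U q" "s' \<in> ?U q'" for q q' s s'
    proof -
      have "real (?m + q) + 1 \<le> real (?m + q')" using that(1) by simp
      then show ?thesis using that by auto
    qed
    show "\<exists>s. range (arrival_times (\<omega> (w ! q))) \<inter> ?U q = {s}" if "q < length w" for q
      using card[OF w[OF that] that] by auto
    show "range (arrival_times (\<omega> k)) \<inter> ?U q = {}" if "k \<le> n" "q < length w" "w ! q \<noteq> k" for k q
      using card[OF that(1,2)] that(3) by auto
  qed
  then have sync: "sites_of n \<omega> (ring_times n \<omega> \<inter> {real ?m..<real (?m + length w)}) = sync_word n"
    unfolding UN_forward_units w_def .
  show ?thesis
  proof (rule window_image_singleton[OF assms(2,3) _ _ _ _ sync])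
    have "0 \<le> real ?m" "real ?m \<le> real (?m + length w)" by simp_all
    then show "ring_times n \<omega> \<inter> {0..<real (?m + length w)} =
        ring_times n \<omega> \<inter> {0..<real ?m} \<union> ring_times n \<omega> \<inter> {real ?m..<real (?m + length w)} \<union> {}"
      by (auto simp del: of_nat_add of_nat_mult)
  qed auto
qed

lemma backward_synchronisation:
  fixes n r :: nat
  defines "w \<equiv> sync_word n"
  assumes "1 \<le> n" "\<omega> \<in> tasep_paths n"
    and pattern: "\<forall>k\<in>{0..n}. \<forall>q<length (rev w). \<exists>a.
     {l. real (r * length (rev w) + q) \<le> (\<Sum>i<Suc l. \<omega> k (- int (Suc i))) \<and>
         (\<Sum>i<Suc l. \<omega> k (- int (Suc i))) < real (r * length (rev w) + q) + 1} =
     {a..<a + (if rev w ! q = k then 1 else 0)}"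
  shows "is_singleton (window_image n \<omega> (- real (r * length w + length w)) 0)"
proof -
  let ?m = "r * length w"
  \<comment> \<open>Counted backwards from 0 the block shows \<open>rev w\<close>, so position
    \<open>q\<close> of \<open>w\<close> belongs to the interval with offset
    \<open>length w - Suc q\<close>.\<close>
  let ?V = "\<lambda>q. {- (real (?m + (length w - Suc q)) + 1)<..- real (?m + (length w - Suc q))}"
  let ?U = "\<lambda>q. ?V q \<inter> {..<0}"
  have card: "\<exists>a. range (arrival_times (\<omega> k)) \<inter> ?U q =
      (\<lambda>l. arrival_times (\<omega> k) (- int (Suc l))) ` {a..<a + (if w ! q = k then 1 else 0)}"
    if "k \<le> n" "q < length w" for k q
  proof -
    have q: "length w - Suc q < length (rev w)" "rev w ! (length w - Suc q) = w ! q"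
      using that(2) by (simp_all add: rev_nth)
    have "k \<in> {0..n}" using that(1) by simp
    from pattern[THEN bspec, OF this, THEN spec, THEN mp, OF q(1), unfolded length_rev q(2)]
    obtain a where a: "{l. real (?m + (length w - Suc q)) \<le> (\<Sum>i<Suc l. \<omega> k (- int (Suc i))) \<and>
        (\<Sum>i<Suc l. \<omega> k (- int (Suc i))) < real (?m + (length w - Suc q)) + 1} =
        {a..<a + (if w ! q = k then 1 else 0)}"
      by (rule exE)
    show ?thesis
      unfolding arrivals_backward_window[OF clock_seqs_of_path[OF assms(3) that(1)]] a
      by (rule exI, rule refl)
  qed
  have w: "w ! q \<le> n" if "q < length w" for q
    using nth_mem[OF that] set_sync_word[of n] unfolding w_def by auto
  have "sites_of n \<omega> (ring_times n \<omega> \<inter> (\<Union>q<length w. ?U q)) = w"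
  proof (rule sites_of_pattern[OF assms(3)])
    show "set w \<subseteq> {0..n}" unfolding w_def by (rule set_sync_word)
    show "s < s'" if "q < q'" "q' < length w" "s \<in> ?U q" "s' \<in> ?U q'" for q q' s s'
    proof -
      have "length w - Suc q' + 1 \<le> length w - Suc q" using that(1,2) by simp
      then have "real (?m + (length w - Suc q')) + 1 \<le> real (?m + (length w - Suc q))"
        by linarith
      then show ?thesis using that(3,4) by auto
    qed
    show "\<exists>s. range (arrival_times (\<omega> (w ! q))) \<inter> ?U q = {s}" if "q < length w" for q
      using card[OF w[OF that] that] by auto
    show "range (arrival_times (\<omega> k)) \<inter> ?U q = {}" if "k \<le> n" "q < length w" "w ! q \<noteq> k" for k q
      using card[OF that(1,2)] that(3) by auto
  qed
  moreover have "(\<Union>q<length w. ?U q) = {- real (?m + length w)<..- real ?m} \<inter> {..<0}"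
    unfolding UN_backward_units[symmetric] by blast
  ultimately have sync: "sites_of n \<omega> (ring_times n \<omega> \<inter> ({- real (?m + length w)<..- real ?m} \<inter> {..<0})) =
      sync_word n"
    unfolding w_def by simp
  show ?thesis
  proof (rule window_image_singleton[OF assms(2,3) _ _ _ _ sync])
    have "w \<noteq> []" unfolding w_def by (rule sync_word_nonempty[OF assms(2)])
    then have "0 < ?m + length w" by simp
    then have "- real (?m + length w) < 0" "0 \<le> real ?m" "real ?m \<le> real (?m + length w)"
      by (simp_all only: neg_less_0_iff_less of_nat_0_less_iff of_nat_0_le_iff of_nat_le_iff le_add1)
    \<comment> \<open>The block is open on the left, while \<open>ring_word\<close> includes the
      left end of its window; a ring exactly there makes up the first piece. The word is nonempty,
      so this end lies strictly below 0.\<close>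
    then show "ring_times n \<omega> \<inter> {- real (?m + length w)..<0} =
        ring_times n \<omega> \<inter> {- real (?m + length w)} \<union>
        ring_times n \<omega> \<inter> ({- real (?m + length w)<..- real ?m} \<inter> {..<0}) \<union>
        ring_times n \<omega> \<inter> {- real ?m<..<0}"
      by (auto simp del: of_nat_add of_nat_mult)
  qed auto
qed

section \<open>Measurability of the attractor\<close>

text \<open>Writes the event that a given word occurs as a countable union over the indices \<open>js\<close> of its rings.\<close>

lemma ring_word_eq_iff:
  assumes "\<omega> \<in> tasep_paths n"
  shows "ring_word n \<omega> a b = w \<longleftrightarrow> set w \<subseteq> {0..n} \<and> (\<exists>js :: int list.
    (\<forall>p<length w. a \<le> arrival_times (\<omega> (w ! p)) (js ! p) \<and> arrival_times (\<omega> (w ! p)) (js ! p) < b) \<and>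
    (\<forall>p<length w. \<forall>q<length w. p < q \<longrightarrow>
       arrival_times (\<omega> (w ! p)) (js ! p) < arrival_times (\<omega> (w ! q)) (js ! q)) \<and>
    (\<forall>k\<in>{0..n}. \<forall>j. a \<le> arrival_times (\<omega> k) j \<and> arrival_times (\<omega> k) j < b \<longrightarrow>
       (\<exists>p<length w. arrival_times (\<omega> k) j = arrival_times (\<omega> (w ! p)) (js ! p))))"
    (is "_ \<longleftrightarrow> _ \<and> (\<exists>js. ?inside js \<and> ?sorted js \<and> ?all js)")
proof
  assume w: "ring_word n \<omega> a b = w"
  define us where "us = sorted_list_of_set (ring_times n \<omega> \<inter> {a..<b})"
  have us: "set us = ring_times n \<omega> \<inter> {a..<b}" "sorted_wrt (<) us"
    unfolding us_def using assms by simp_all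
  have w_us: "w = map (ring_site n \<omega>) us"
    using w by (simp add: ring_word_def sites_of_def us_def)
  have "\<exists>j. arrival_times (\<omega> (w ! p)) j = us ! p" if p: "p < length us" for p
  proof -
    have "us ! p \<in> ring_times n \<omega>" using nth_mem[OF p] us(1) by blast
    then obtain k j where k: "k \<le> n" "us ! p = arrival_times (\<omega> k) j" by (auto simp: ring_times_def)
    then have "w ! p = k" using p ring_site_arrival[OF assms k(1)] by (simp add: w_us)
    with k show ?thesis by metis
  qed
  then obtain J where J: "\<And>p. p < length us \<Longrightarrow> arrival_times (\<omega> (w ! p)) (J p) = us ! p" by metis
  define js where "js = map J [0..<length us]"
  have js: "arrival_times (\<omega> (w ! p)) (js ! p) = us ! p" if "p < length w" for p
    using that J by (simp add: w_us js_def)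
  have mem: "us ! p \<in> ring_times n \<omega> \<inter> {a..<b}" if "p < length w" for p
    using that us(1) nth_mem[of p us] by (simp add: w_us)
  have "?inside js" using js mem by auto
  moreover have "?sorted js" using js us(2) by (auto simp: w_us sorted_wrt_iff_nth_less)
  moreover have "?all js"
  proof (intro ballI allI impI)
    fix k j assume "k \<in> {0..n}" "a \<le> arrival_times (\<omega> k) j \<and> arrival_times (\<omega> k) j < b"
    then have "arrival_times (\<omega> k) j \<in> set us" unfolding us(1) by (auto simp: ring_times_def)
    then obtain p where "p < length us" "us ! p = arrival_times (\<omega> k) j" by (auto simp: in_set_conv_nth)
    then show "\<exists>p<length w. arrival_times (\<omega> k) j = arrival_times (\<omega> (w ! p)) (js ! p)"
      using js[of p] by (intro exI[of _ p]) (simp add: w_us)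
  qed
  moreover have "set w \<subseteq> {0..n}" using w set_ring_word[OF assms] by blast
  ultimately show "set w \<subseteq> {0..n} \<and> (\<exists>js. ?inside js \<and> ?sorted js \<and> ?all js)" by blast
next
  assume *: "set w \<subseteq> {0..n} \<and> (\<exists>js. ?inside js \<and> ?sorted js \<and> ?all js)"
  then obtain js where js: "?inside js" "?sorted js" "?all js" by blast
  define us where "us = map (\<lambda>p. arrival_times (\<omega> (w ! p)) (js ! p)) [0..<length w]"
  have le: "w ! p \<le> n" if "p < length w" for p using nth_mem[OF that] * by auto
  have "sorted_wrt (<) us" using js(2) by (simp add: us_def sorted_wrt_iff_nth_less)
  moreover have "set us = ring_times n \<omega> \<inter> {a..<b}"
  proof
    show "set us \<subseteq> ring_times n \<omega> \<inter> {a..<b}"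
    proof
      fix s assume "s \<in> set us"
      then obtain p where p: "p < length w" "s = arrival_times (\<omega> (w ! p)) (js ! p)"
        by (auto simp: us_def)
      then show "s \<in> ring_times n \<omega> \<inter> {a..<b}" using js(1) le[OF p(1)] by (auto simp: ring_times_def)
    qed
    show "ring_times n \<omega> \<inter> {a..<b} \<subseteq> set us"
    proof
      fix s assume "s \<in> ring_times n \<omega> \<inter> {a..<b}"
      then obtain k j where "k \<in> {0..n}" "s = arrival_times (\<omega> k) j" "a \<le> s" "s < b"
        by (auto simp: ring_times_def)
      then obtain p where "p < length w" "s = arrival_times (\<omega> (w ! p)) (js ! p)" using js(3) by blast
      then show "s \<in> set us" by (auto simp: us_def)
    qed
  qed
  ultimately have "sorted_list_of_set (ring_times n \<omega> \<inter> {a..<b}) = us"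
    by (metis sorted_list_of_set.idem_if_sorted_distinct strict_sorted_iff)
  moreover have "map (ring_site n \<omega>) us = w"
    using ring_site_arrival[OF assms le] by (intro nth_equalityI) (simp_all add: us_def)
  ultimately show "ring_word n \<omega> a b = w" by (simp add: ring_word_def sites_of_def)
qed

lemma measurable_arrival_times_clock [measurable]:
  "(\<lambda>\<xi>. arrival_times \<xi> j) \<in> borel_measurable (clock_space r)"
  unfolding arrival_times_def by measurable

lemma measurable_arrival_times [measurable]:
  "(\<lambda>\<omega>. arrival_times (\<omega> k) j) \<in> borel_measurable (\<Pi>\<^sub>M k\<in>I. clock_space (rate k))"
proof (cases "k \<in> I")
  \<comment> \<open>The index may lie outside \<open>I\<close>, as a letter of an unrestricted word
    in \<open>sets_ring_word\<close> can. There every path has the value \<open>undefined\<close>,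
    so the map is constant.\<close>
  case False
  have "\<omega> k = undefined" if "\<omega> \<in> space (\<Pi>\<^sub>M k\<in>I. clock_space (rate k))" for \<omega>
    using that False unfolding space_PiM by (rule PiE_arb)
  then have "(\<lambda>\<omega>. arrival_times (\<omega> k) j) \<in> borel_measurable (\<Pi>\<^sub>M k\<in>I. clock_space (rate k)) \<longleftrightarrow>
      (\<lambda>_. arrival_times undefined j) \<in> borel_measurable (\<Pi>\<^sub>M k\<in>I. clock_space (rate k))"
    by (intro measurable_cong) simp
  then show ?thesis by simp
next
  case True
  then have "(\<lambda>\<omega>. \<omega> k) \<in> measurable (\<Pi>\<^sub>M k\<in>I. clock_space (rate k)) (clock_space (rate k))"
    by (rule measurable_component_singleton)
  then show ?thesis by (rule measurable_compose) (rule measurable_arrival_times_clock)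
qed

lemma sets_distinct_arrivals:
  "distinct_arrivals n \<inter> space (\<Pi>\<^sub>M k\<in>{0..n}. clock_space (rate k))
    \<in> sets (\<Pi>\<^sub>M k\<in>{0..n}. clock_space (rate k))"
proof -
  have "{\<omega>\<in>space (\<Pi>\<^sub>M k\<in>{0..n}. clock_space (rate k)). \<forall>k\<in>{0..n}. \<forall>k'\<in>{0..n}. k \<noteq> k' \<longrightarrow>
      (\<forall>i j. arrival_times (\<omega> k) i \<noteq> arrival_times (\<omega> k') j)}
      \<in> sets (\<Pi>\<^sub>M k\<in>{0..n}. clock_space (rate k))"
    by (intro sets.sets_Collect_finite_All sets.sets_Collect_imp sets.sets_Collect_const
        sets.sets_Collect_countable_All borel_measurable_neq measurable_arrival_times) auto
  moreover have "distinct_arrivals n \<inter> space (\<Pi>\<^sub>M k\<in>{0..n}. clock_space (rate k)) =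
      {\<omega>\<in>space (\<Pi>\<^sub>M k\<in>{0..n}. clock_space (rate k)). \<forall>k\<in>{0..n}. \<forall>k'\<in>{0..n}. k \<noteq> k' \<longrightarrow>
      (\<forall>i j. arrival_times (\<omega> k) i \<noteq> arrival_times (\<omega> k') j)}"
    by (rule set_eqI) (unfold distinct_arrivals_def Int_iff mem_Collect_eq, rule conj_commute)
  ultimately show ?thesis by (simp only:)
qed

lemma space_tasep_space [simp]: "space (tasep_space \<alpha> \<beta> h n) = tasep_paths n"
  by (simp add: tasep_space_def tasep_paths_def space_restrict_space space_PiM Int_commute)

lemma sets_ring_word:
  "{\<omega>\<in>space (tasep_space \<alpha> \<beta> h n). ring_word n \<omega> a b = w} \<in> sets (tasep_space \<alpha> \<beta> h n)"
proof -
  have m: "(\<lambda>\<omega>. arrival_times (\<omega> k) j) \<in> borel_measurable (tasep_space \<alpha> \<beta> h n)" for k j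
    unfolding tasep_space_def by (rule measurable_restrict_space1) (rule measurable_arrival_times)
  let ?T = "\<lambda>\<omega> k j. arrival_times (\<omega> k :: int \<Rightarrow> real) j"
  have "{\<omega>\<in>space (tasep_space \<alpha> \<beta> h n). set w \<subseteq> {0..n} \<and> (\<exists>js :: int list.
    (\<forall>p<length w. a \<le> ?T \<omega> (w ! p) (js ! p) \<and> ?T \<omega> (w ! p) (js ! p) < b) \<and>
    (\<forall>p<length w. \<forall>q<length w. p < q \<longrightarrow> ?T \<omega> (w ! p) (js ! p) < ?T \<omega> (w ! q) (js ! q)) \<and>
    (\<forall>k\<in>{0..n}. \<forall>j. a \<le> ?T \<omega> k j \<and> ?T \<omega> k j < b \<longrightarrow>
       (\<exists>p<length w. ?T \<omega> k j = ?T \<omega> (w ! p) (js ! p))))} \<in> sets (tasep_space \<alpha> \<beta> h n)"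
    by (intro sets.sets_Collect_conj sets.sets_Collect_const sets.sets_Collect_countable_Ex
        sets.sets_Collect_countable_All sets.sets_Collect_imp sets.sets_Collect_finite_All
        borel_measurable_le borel_measurable_less borel_measurable_eq borel_measurable_const m) auto
  also have "{\<omega>\<in>space (tasep_space \<alpha> \<beta> h n). set w \<subseteq> {0..n} \<and> (\<exists>js :: int list.
    (\<forall>p<length w. a \<le> ?T \<omega> (w ! p) (js ! p) \<and> ?T \<omega> (w ! p) (js ! p) < b) \<and>
    (\<forall>p<length w. \<forall>q<length w. p < q \<longrightarrow> ?T \<omega> (w ! p) (js ! p) < ?T \<omega> (w ! q) (js ! q)) \<and>
    (\<forall>k\<in>{0..n}. \<forall>j. a \<le> ?T \<omega> k j \<and> ?T \<omega> k j < b \<longrightarrow>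
       (\<exists>p<length w. ?T \<omega> k j = ?T \<omega> (w ! p) (js ! p))))} =
    {\<omega>\<in>space (tasep_space \<alpha> \<beta> h n). ring_word n \<omega> a b = w}"
    by (rule Collect_cong, rule conj_cong[OF refl], rule ring_word_eq_iff[symmetric]) simp
  finally show ?thesis .
qed

text \<open>The images decrease as the window grows, so integer start times suffice, and the
  uncountable intersection becomes a countable one, as measurability requires.\<close>

lemma tasep_attractor_eq_nat:
  assumes "1 \<le> n" "\<omega> \<in> tasep_paths n"
  shows "tasep_attractor n \<omega> = (\<Inter>m::nat. window_image n \<omega> (- real m) 0)"
proof
  show "tasep_attractor n \<omega> \<subseteq> (\<Inter>m::nat. window_image n \<omega> (- real m) 0)"
    unfolding tasep_attractor_eq[OF assms(2)] by (intro INF_mono) auto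
  show "(\<Inter>m::nat. window_image n \<omega> (- real m) 0) \<subseteq> tasep_attractor n \<omega>"
    unfolding tasep_attractor_eq[OF assms(2)]
  proof (rule INF_greatest)
    fix s :: real assume s: "s \<in> {0..}"
    obtain m :: nat where "s \<le> real m" using real_arch_simple by blast
    with s have "window_image n \<omega> (- real m) 0 \<subseteq> window_image n \<omega> (- s) 0"
      by (intro window_image_mono[OF assms]) auto
    then show "(\<Inter>m::nat. window_image n \<omega> (- real m) 0) \<subseteq> window_image n \<omega> (- s) 0"
      by (intro INF_lower2[of m]) auto
  qed
qed

lemma compact_random_set_tasep_attractor:
  assumes "1 \<le> n"
  shows "compact_random_set (tasep_space \<alpha> \<beta> h n) (tasep_states n) (tasep_attractor n)"
proof -
  let ?M = "tasep_space \<alpha> \<beta> h n"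
  have sub: "tasep_attractor n \<omega> \<subseteq> tasep_states n" if "\<omega> \<in> space ?M" for \<omega>
    using tasep_attractor_subset_nonempty[OF assms] that by simp
  have section_sets: "{\<omega>\<in>space ?M. x \<in> tasep_attractor n \<omega>} \<in> sets ?M" for x
  proof -
    \<comment> \<open>There are only countably many words, so membership in a window image is a
      countable union of the events of \<open>sets_ring_word\<close>.\<close>
    have "{\<omega>\<in>space ?M. x \<in> tasep_attractor n \<omega>} =
        {\<omega>\<in>space ?M. \<forall>m::nat. \<exists>w\<in>{w. x \<in> hops n w ` tasep_states n}. ring_word n \<omega> (- real m) 0 = w}"
      by (auto simp: tasep_attractor_eq_nat[OF assms] window_image_def)
    also have "\<dots> \<in> sets ?M"
      by (intro sets.sets_Collect_countable_All sets.sets_Collect_countable_Ex' sets_ring_word) auto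
    finally show ?thesis .
  qed
  have "{(x, \<omega>). \<omega> \<in> space ?M \<and> x \<in> tasep_attractor n \<omega>} =
      (\<Union>x\<in>tasep_states n. {x} \<times> {\<omega>\<in>space ?M. x \<in> tasep_attractor n \<omega>})"
    using sub by blast
  also have "\<dots> \<in> sets (count_space (tasep_states n) \<Otimes>\<^sub>M ?M)"
    by (intro sets.finite_UN pair_measureI section_sets) auto
  finally show ?thesis
    using sub finite_subset[OF sub finite_tasep_states]
    unfolding compact_random_set_def random_set_def compactin_discrete_topology by blast
qed

section \<open>Transfer to paths with distinct arrivals and assembly of the attractor
  properties\<close>

lemma AE_tasep_pattern:
  assumes "\<forall>k\<le>n. 0 < tasep_rate \<alpha> \<beta> h n k" "gap_order e" "v \<noteq> []"
  shows "AE \<omega> in tasep_space \<alpha> \<beta> h n. \<exists>r. \<forall>k\<in>{0..n}. \<forall>q<length v. \<exists>a.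
     {l. real (r * length v + q) \<le> (\<Sum>i<Suc l. \<omega> k (e i)) \<and>
         (\<Sum>i<Suc l. \<omega> k (e i)) < real (r * length v + q) + 1} =
     {a..<a + (if v ! q = k then 1 else 0)}"
proof -
  interpret poisson_clocks n "tasep_rate \<alpha> \<beta> h n" e v
    using assms by unfold_locales auto
  have space: "distinct_arrivals n \<inter> space clocks \<in> sets clocks"
    unfolding clocks_def by (rule sets_distinct_arrivals)
  have eq: "tasep_space \<alpha> \<beta> h n = restrict_space clocks (distinct_arrivals n)"
    by (simp add: tasep_space_def clocks_def)
  show ?thesis
    unfolding eq AE_restrict_space_iff[OF space] using AE_pattern by (rule eventually_mono) blast
qed

theorem theorem13:
  fixes n :: nat and \<alpha> \<beta> :: real and h :: "nat \<Rightarrow> real"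
  assumes "n \<ge> 1" and "\<alpha> > 0" and "\<beta> > 0"
    and "\<And>k. 1 \<le> k \<Longrightarrow> k \<le> n - 1 \<Longrightarrow> h k > 0"
  shows "global_random_forward_attractor (tasep_space \<alpha> \<beta> h n) (tasep_states n)
           (tasep_flow n) (tasep_cocycle n) (tasep_attractor n)
       \<and> global_random_pullback_attractor (tasep_space \<alpha> \<beta> h n) (tasep_states n)
           (tasep_flow n) (tasep_cocycle n) (tasep_attractor n)
       \<and> (AE \<omega> in tasep_space \<alpha> \<beta> h n. is_singleton (tasep_attractor n \<omega>))"
proof -
  let ?M = "tasep_space \<alpha> \<beta> h n" and ?L = "length (sync_word n)"
  have rate: "\<forall>k\<le>n. 0 < tasep_rate \<alpha> \<beta> h n k"
    using assms by (simp add: tasep_rate_def)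
  have paths: "AE \<omega> in ?M. \<omega> \<in> tasep_paths n"
    using AE_space[of ?M] by simp
  have w: "sync_word n \<noteq> []" "rev (sync_word n) \<noteq> []"
    using sync_word_nonempty[OF assms(1)] by simp_all
  have "AE \<omega> in ?M. \<exists>r. is_singleton (window_image n \<omega> 0 (real (r * ?L + ?L)))"
    using paths AE_tasep_pattern[OF rate gap_order_int w(1)]
    by eventually_elim (blast intro: forward_synchronisation[OF assms(1)])
  with paths have forward: "AE \<omega> in ?M.
      ((\<lambda>t. hausdorff_semidist ((\<lambda>x. tasep_cocycle n t x \<omega>) ` tasep_states n)
        (tasep_attractor n (tasep_flow n t \<omega>))) \<longlongrightarrow> 0) at_top"
    by eventually_elim (blast intro: tasep_forward_convergence[OF assms(1)] of_nat_0_le_iff)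
  \<comment> \<open>The gaps before 0 are read away from the origin, hence the pattern to wait for
    is the reversed word; block \<open>r\<close> then ends at distance \<open>r * ?L + ?L\<close> in
    the past.\<close>
  have "AE \<omega> in ?M. \<exists>r. is_singleton (window_image n \<omega> (- real (r * ?L + ?L)) 0)"
    using paths AE_tasep_pattern[OF rate gap_order_minus_Suc w(2)]
    by eventually_elim (blast intro: backward_synchronisation[OF assms(1)])
  with paths have singleton: "AE \<omega> in ?M. is_singleton (tasep_attractor n \<omega>)"
  proof eventually_elim
    case (elim \<omega>)
    then obtain r where r: "is_singleton (window_image n \<omega> (- real (r * ?L + ?L)) 0)" by blast
    show ?case
      by (rule tasep_attractor_singleton[OF assms(1) elim(1) _ r]) (simp only: neg_le_0_iff_le of_nat_0_le_iff)
  qed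
  have invariant: "invariant_random_set ?M (tasep_flow n) (tasep_cocycle n) (tasep_attractor n)"
    unfolding invariant_random_set_def
    using paths by eventually_elim (use tasep_attractor_invariant[OF assms(1)] in blast)
  have pullback: "AE \<omega> in ?M.
      ((\<lambda>t. hausdorff_semidist ((\<lambda>x. tasep_cocycle n t x (tasep_flow n (- t) \<omega>)) ` tasep_states n)
        (tasep_attractor n \<omega>)) \<longlongrightarrow> 0) at_top"
    using paths by eventually_elim (rule tasep_pullback_convergence[OF assms(1)])
  show ?thesis
    unfolding global_random_forward_attractor_def global_random_pullback_attractor_def
    using compact_random_set_tasep_attractor[OF assms(1)] invariant forward pullback singleton by blast
qed

end
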